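(* Let $\preceq$ be a partial order on a countable set $\mathcal S$, let $\Pi=\Pi^{is}(\cdot\mid\mathcal P^{is}):\mathcal P\to\mathcal P$ be the isotonic regression map (the $\ell_2$-projection onto the set $\mathcal P^{is}$ of isotonic probability vectors), let $\boldsymbol p\in\mathcal P$ be any underlying distribution on $\mathcal S$ (not necessarily isotonic), let $d\in\{1,2\}$, and let $$\hat{\boldsymbol\phi}_n=\beta^{(L_d)}_n\,\Pi^{is}(\hat{\boldsymbol p}_n\mid\mathcal P^{is})+(1-\beta^{(L_d)}_n)\hat{\boldsymbol p}_n$$ be the Grenander–Stone estimator with mixture parameter selected by leave-one-out cross-validation with loss $L_d$. Then $\Pi=\Pi^{is}(\cdot\mid\mathcal P^{is})$ satisfies all of the properties (i)–(v) listed in the context. Therefore: (a) for every $1\le k\le\infty$, $\hat{\boldsymbol\phi}_n$ is strongly consistent in $\ell_k$-norm, i.e. $\|\hat{\boldsymbol\phi}_n-\boldsymbol p\|_k\to0$ almost surely as $n\to\infty$; (b) for every $2\le k\le\infty$, $n^{1/2}\|\hat{\boldsymbol\phi}_n-\boldsymbol p\|_k=O_p(1)$; (c) if in addition $\sum_{j=0}^\infty\sqrt{p_j}<\infty$, then $n^{1/2}\|\hat{\boldsymbol\phi}_n-\boldsymbol p\|_1=O_p(1)$.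
   Context: Notation. $\mathcal S=\{\boldsymbol s_0,\boldsymbol s_1,\dots\}$ is a countable set with a partial order $\preceq$; vectors are indexed by $j\in\mathbb N=\{0,1,\dots\}$ (coordinate $j$ corresponds to $\boldsymbol s_j$; finite vectors are extended by zeros). $\mathcal P=\{\boldsymbol f\in\ell_1:\ f_j\ge0,\ \sum_jf_j=1\}$. $\|\cdot\|_k$ is the $\ell_k$-norm ($k\in\{1,2,\dots\}\cup\{\infty\}$), $\langle\cdot,\cdot\rangle$ the $\ell_2$ inner product. For real random variables $b_n$, $b_n=O_p(n^q)$ means: for every $\varepsilon>0$ there are finite $M,N>0$ with $\mathbb P(n^{-q}|b_n|>M)<\varepsilon$ for all $n>N$. Isotonic regression. A probability vector $\boldsymbol f\in\mathcal P$ is isotonic if $\boldsymbol s_i\preceq\boldsymbol s_j$ implies $f_i\le f_j$. $\mathcal P^{is}\subset\mathcal P$ is the set of all isotonic probability vectors. For $\boldsymbol g\in\mathcal P$, $$\Pi^{is}(\boldsymbol g\mid\mathcal P^{is})=\arg\min_{\boldsymbol f\in\mathcal P^{is}}\sum_j(f_j-g_j)^2,$$ the $\ell_2$-projection of $\boldsymbol g$ onto $\mathcal P^{is}$. Data. $\boldsymbol z_1,\boldsymbol z_2,\dots$ are i.i.d. $\mathcal S$-valued with p.m.f. $\boldsymbol p\in\mathcal P$. For each $n$: $x_j=\sum_{i=1}^n1\{\boldsymbol z_i=\boldsymbol s_j\}$, $\boldsymbol x=(x_0,\dots,x_{t_n})$ with $t_n=\sup\{j:x_j>0\}$, $\hat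 p_{n,j}=x_j/n$. For $n\ge2$ and $j$ with $x_j>0$: $\hat{\boldsymbol p}^{\backslash[j]}_n=(\boldsymbol x-\boldsymbol\sigma^{[j]})/(n-1)$, where $\boldsymbol\sigma^{[j]}$ has entry $1$ at index $j$ and $0$ elsewhere, and $\hat{\boldsymbol g}^{\backslash[j]}_n=\Pi(\hat{\boldsymbol p}^{\backslash[j]}_n)$ with $\Pi=\Pi^{is}(\cdot\mid\mathcal P^{is})$; for $j$ with $x_j=0$ put $\hat{\boldsymbol g}^{\backslash[j]}_n=0$. Mixture parameters selected by leave-one-out cross-validation. For loss $L_1$: $\beta^{(L_1)}_n=0$ if $\sum_{j=0}^{t_n}\{(x_j-n\hat g^{\backslash[j]}_{n,j})^2+(n+1)\hat g^{\backslash[j]}_{n,j}(x_j-n\hat g^{\backslash[j]}_{n,j})+n(\hat g^{\backslash[j]}_{n,j})^2\}\ge n$, and $\beta^{(L_1)}_n=1$ otherwise. For loss $L_2$: $\beta^{(L_2)}_n=b_n/a_n$ if $a_n\neq0$ and $0\le b_n\le a_n$; $\beta^{(L_2)}_n=0$ if $a_n=0$ or $b_n<0$; $\beta^{(L_2)}_n=1$ otherwise, where $$a_n=n-\sum_{j=0}^{t_n}x_j\Big\{2(x_j-\hat g^{\backslash[j]}_{n,j}(n-1))-\sum_{k=0}^{t_n}(x_k-(n-1)\hat g^{\backslash[j]}_{n,k})^2\Big\},$$ $$b_n=n^2-\sum_{j=0}^{t_n}x_j^2+(n-1)\sum_{j=0}^{t_n}x_j\sum_{k=0}^{t_n}x_k(\hat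 g^{\backslash[k]}_{n,k}-\hat g^{\backslash[j]}_{n,k}).$$ Properties of a map $\Pi:\mathcal P\to\mathcal P$: (i) $\Pi$ is continuous from $\ell_2$ to $\ell_2$. (ii) $\Pi$ is a contraction with respect to the $\ell_\infty$-norm, i.e. $\|\Pi(\boldsymbol f)-\Pi(\boldsymbol h)\|_\infty\le\|\boldsymbol f-\boldsymbol h\|_\infty$. (iii) $\langle\Pi(\boldsymbol f),\boldsymbol f-\Pi(\boldsymbol f)\rangle=0$ and $\langle\boldsymbol f,\boldsymbol f-\Pi(\boldsymbol f)\rangle\ge0$ for every $\boldsymbol f\in\mathcal P$. (iv) There is a real sequence $c_n\to1$ such that for any frequency data $\boldsymbol x$ (of sample size $n$), $c_n\hat{\boldsymbol\gamma}_n\le\Pi(\hat{\boldsymbol p}_n)$ coordinatewise, where $\hat\gamma_{n,j}=\Pi(\hat{\boldsymbol p}^{\backslash[j]}_n)_j$ if $x_j>0$ and $\hat\gamma_{n,j}=0$ otherwise. (v) If the true distribution satisfies $\Pi(\boldsymbol p)=\boldsymbol p$, then $n^{1/2}\|\Pi(\hat{\boldsymbol p}_n)-\boldsymbol p\|_k=O_p(1)$ for $2\le k\le\infty$, and if in addition $\sum_{j}\sqrt{p_j}<\infty$, then $n^{1/2}\|\Pi(\hat{\boldsymbol p}_n)-\boldsymbol p\|_1=O_p(1)$.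
   Formalization: It is additionally assumed that every element of S has only finitely many elements above it; otherwise the projection onto the isotonic probability vectors is undefined for some g (e.g. the naturals with the usual order) or property (iii) fails. *)

theory Defs
  imports "HOL-Probability.Probability" "HOL-Library.Extended_Nat"
begin

text \<open>
  The countable set \<open>S\<close> is enumerated by a bijection \<open>s\<close> from an index set \<open>J\<close>, which is either
  all of \<open>nat\<close> or an initial segment \<open>{..<N}\<close> (finite \<open>S\<close>).  A vector over \<open>S\<close> is a function
  \<open>nat \<Rightarrow> real\<close> that vanishes outside \<open>J\<close>.  The partial order on \<open>S\<close> is a relation \<open>r\<close>, with
  \<open>(a, b) \<in> r\<close> for ``\<open>a\<close> precedes \<open>b\<close>''.
\<close>

definition pvecs :: "nat set \<Rightarrow> (nat \<Rightarrow> real) set" where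
  "pvecs J = {f. (\<forall>j. 0 \<le> f j) \<and> (\<forall>j. j \<notin> J \<longrightarrow> f j = 0) \<and> f sums 1}"

text \<open>
  The \<open>\<ell>\<^sub>k\<close>-norm, \<open>k \<in> {1, 2, \<dots>} \<union> {\<infinity>}\<close>.  It is real-valued, hence meaningful only where the series
  converges (or the supremum is finite); below it is applied to differences of members of
  \<open>pvecs J\<close>, which are absolutely summable.
\<close>

definition lnorm :: "enat \<Rightarrow> (nat \<Rightarrow> real) \<Rightarrow> real" where
  "lnorm k v = (case k of
       enat m \<Rightarrow> root m (\<Sum>j. \<bar>v j\<bar> ^ m)
     | \<infinity> \<Rightarrow> (SUP j. \<bar>v j\<bar>))"

definition l2_inner :: "(nat \<Rightarrow> real) \<Rightarrow> (nat \<Rightarrow> real) \<Rightarrow> real" where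
  "l2_inner f g = (\<Sum>j. f j * g j)"

text \<open>
  \<open>b\<^sub>n = O\<^sub>p(n\<^sup>q)\<close>.  Measurability of every \<open>b\<^sub>n\<close> is part of the definition, because
  \<^const>\<open>measure\<close> is \<open>0\<close> on non-measurable sets.
\<close>

definition bigO_prob :: "'w measure \<Rightarrow> (nat \<Rightarrow> 'w \<Rightarrow> real) \<Rightarrow> real \<Rightarrow> bool" where
  "bigO_prob M b q \<longleftrightarrow>
     (\<forall>n. b n \<in> borel_measurable M) \<and>
     (\<forall>\<epsilon>>0. \<exists>K>0. \<exists>N>0. \<forall>n>N.
        measure M {\<omega> \<in> space M. real n powr (- q) * \<bar>b n \<omega>\<bar> > K} < \<epsilon>)"


subsection \<open>Isotonic regression\<close>

definition isotonic_pvecs ::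
    "nat set \<Rightarrow> (nat \<Rightarrow> 'a) \<Rightarrow> 'a rel \<Rightarrow> (nat \<Rightarrow> real) set" where
  "isotonic_pvecs J s r =
     {f \<in> pvecs J. \<forall>i\<in>J. \<forall>j\<in>J. (s i, s j) \<in> r \<longrightarrow> f i \<le> f j}"

definition sq_dist :: "(nat \<Rightarrow> real) \<Rightarrow> (nat \<Rightarrow> real) \<Rightarrow> real" where
  "sq_dist g f = (\<Sum>j. (f j - g j)\<^sup>2)"

text \<open>
  On an arbitrary infinite poset the minimiser need not exist (for \<open>nat\<close> with its usual order
  there is no isotonic probability vector at all); then the value is unspecified.
\<close>

definition isotonic_proj ::
    "nat set \<Rightarrow> (nat \<Rightarrow> 'a) \<Rightarrow> 'a rel \<Rightarrow> (nat \<Rightarrow> real) \<Rightarrow> nat \<Rightarrow> real" where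
  "isotonic_proj J s r g = arg_min (sq_dist g) (\<lambda>f. f \<in> isotonic_pvecs J s r)"


subsection \<open>Frequency data and the leave-one-out fits\<close>

definition freq_data :: "nat set \<Rightarrow> nat \<Rightarrow> (nat \<Rightarrow> nat) set" where
  "freq_data J n =
     {x. {j. x j > 0} \<subseteq> J \<and> finite {j. x j > 0} \<and> (\<Sum>j | x j > 0. x j) = n}"

text \<open>
  The observations are \<open>z 1, z 2, \<dots>\<close>.  The guard \<open>j \<in> J\<close> is needed since \<open>s\<close> is arbitrary
  outside \<open>J\<close>.
\<close>

definition counts ::
    "nat set \<Rightarrow> (nat \<Rightarrow> 'a) \<Rightarrow> (nat \<Rightarrow> 'w \<Rightarrow> 'a) \<Rightarrow> nat \<Rightarrow> 'w \<Rightarrow> nat \<Rightarrow> nat" where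
  "counts J s z n \<omega> j = (if j \<in> J then card {i \<in> {1..n}. z i \<omega> = s j} else 0)"

definition emp :: "nat \<Rightarrow> (nat \<Rightarrow> nat) \<Rightarrow> nat \<Rightarrow> real" where
  "emp n x j = real (x j) / real n"

definition last_index :: "(nat \<Rightarrow> nat) \<Rightarrow> nat" where
  "last_index x = Sup {j. x j > 0}"

text \<open>Meaningful for \<open>n \<ge> 2\<close> and \<open>x j > 0\<close>.\<close>

definition loo_emp :: "nat \<Rightarrow> (nat \<Rightarrow> nat) \<Rightarrow> nat \<Rightarrow> nat \<Rightarrow> real" where
  "loo_emp n x j = (\<lambda>k. (real (x k) - (if k = j then 1 else 0)) / (real n - 1))"

definition loo_fit ::
    "((nat \<Rightarrow> real) \<Rightarrow> nat \<Rightarrow> real) \<Rightarrow> nat \<Rightarrow> (nat \<Rightarrow> nat) \<Rightarrow> nat \<Rightarrow> nat \<Rightarrow> real" where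
  "loo_fit T n x j = (if x j > 0 then T (loo_emp n x j) else (\<lambda>_. 0))"


subsection \<open>Mixture parameters selected by leave-one-out cross-validation\<close>

definition beta_L1 ::
    "((nat \<Rightarrow> real) \<Rightarrow> nat \<Rightarrow> real) \<Rightarrow> nat \<Rightarrow> (nat \<Rightarrow> nat) \<Rightarrow> real" where
  "beta_L1 T n x =
     (let g = loo_fit T n x in
      if (\<Sum>j\<le>last_index x.
            (real (x j) - real n * g j j)\<^sup>2
            + (real n + 1) * g j j * (real (x j) - real n * g j j)
            + real n * (g j j)\<^sup>2) \<ge> real n
      then 0 else 1)"

definition coeff_a ::
    "((nat \<Rightarrow> real) \<Rightarrow> nat \<Rightarrow> real) \<Rightarrow> nat \<Rightarrow> (nat \<Rightarrow> nat) \<Rightarrow> real" where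
  "coeff_a T n x =
     (let g = loo_fit T n x; t = last_index x in
      real n - (\<Sum>j\<le>t. real (x j) *
        (2 * (real (x j) - g j j * (real n - 1))
         - (\<Sum>k\<le>t. (real (x k) - (real n - 1) * g j k)\<^sup>2))))"

definition coeff_b ::
    "((nat \<Rightarrow> real) \<Rightarrow> nat \<Rightarrow> real) \<Rightarrow> nat \<Rightarrow> (nat \<Rightarrow> nat) \<Rightarrow> real" where
  "coeff_b T n x =
     (let g = loo_fit T n x; t = last_index x in
      (real n)\<^sup>2 - (\<Sum>j\<le>t. (real (x j))\<^sup>2)
      + (real n - 1) *
          (\<Sum>j\<le>t. real (x j) * (\<Sum>k\<le>t. real (x k) * (g k k - g j k))))"

definition beta_L2 ::
    "((nat \<Rightarrow> real) \<Rightarrow> nat \<Rightarrow> real) \<Rightarrow> nat \<Rightarrow> (nat \<Rightarrow> nat) \<Rightarrow> real" where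
  "beta_L2 T n x =
     (let a = coeff_a T n x; b = coeff_b T n x in
      if a \<noteq> 0 \<and> 0 \<le> b \<and> b \<le> a then b / a
      else if a = 0 \<or> b < 0 then 0
      else 1)"

text \<open>The loss \<open>L\<^sub>d\<close> is used only for \<open>d \<in> {1, 2}\<close>.\<close>

definition beta_L ::
    "nat \<Rightarrow> ((nat \<Rightarrow> real) \<Rightarrow> nat \<Rightarrow> real) \<Rightarrow> nat \<Rightarrow> (nat \<Rightarrow> nat) \<Rightarrow> real" where
  "beta_L d T n x = (if d = 1 then beta_L1 T n x else beta_L2 T n x)"

definition stone_estimator ::
    "nat \<Rightarrow> ((nat \<Rightarrow> real) \<Rightarrow> nat \<Rightarrow> real) \<Rightarrow> nat \<Rightarrow> (nat \<Rightarrow> nat) \<Rightarrow> nat \<Rightarrow> real" where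
  "stone_estimator d T n x =
     (\<lambda>j. beta_L d T n x * T (emp n x) j + (1 - beta_L d T n x) * emp n x j)"


subsection \<open>Properties of a map from probability vectors to probability vectors\<close>

definition l2_continuous :: "nat set \<Rightarrow> ((nat \<Rightarrow> real) \<Rightarrow> nat \<Rightarrow> real) \<Rightarrow> bool" where
  "l2_continuous J T \<longleftrightarrow>
     (\<forall>f\<in>pvecs J. \<forall>\<epsilon>>0. \<exists>\<delta>>0. \<forall>h\<in>pvecs J.
        lnorm 2 (\<lambda>j. h j - f j) < \<delta> \<longrightarrow> lnorm 2 (\<lambda>j. T h j - T f j) < \<epsilon>)"

definition linf_contraction :: "nat set \<Rightarrow> ((nat \<Rightarrow> real) \<Rightarrow> nat \<Rightarrow> real) \<Rightarrow> bool" where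
  "linf_contraction J T \<longleftrightarrow>
     (\<forall>f\<in>pvecs J. \<forall>h\<in>pvecs J.
        lnorm \<infinity> (\<lambda>j. T f j - T h j) \<le> lnorm \<infinity> (\<lambda>j. f j - h j))"

definition orthogonal_residual :: "nat set \<Rightarrow> ((nat \<Rightarrow> real) \<Rightarrow> nat \<Rightarrow> real) \<Rightarrow> bool" where
  "orthogonal_residual J T \<longleftrightarrow>
     (\<forall>f\<in>pvecs J. l2_inner (T f) (\<lambda>j. f j - T f j) = 0 \<and>
                  l2_inner f (\<lambda>j. f j - T f j) \<ge> 0)"

text \<open>
  \<open>loo_fit T n x j j\<close> is the vector of leave-one-out predictions at the left-out index.
\<close>

definition loo_dominated :: "nat set \<Rightarrow> ((nat \<Rightarrow> real) \<Rightarrow> nat \<Rightarrow> real) \<Rightarrow> bool" where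
  "loo_dominated J T \<longleftrightarrow>
     (\<exists>c :: nat \<Rightarrow> real. c \<longlonglongrightarrow> 1 \<and>
        (\<forall>n\<ge>2. \<forall>x\<in>freq_data J n. \<forall>j. c n * loo_fit T n x j j \<le> T (emp n x) j))"

definition root_n_rate_if_fixed ::
    "'w measure \<Rightarrow> ((nat \<Rightarrow> real) \<Rightarrow> nat \<Rightarrow> real) \<Rightarrow> (nat \<Rightarrow> real) \<Rightarrow>
     (nat \<Rightarrow> 'w \<Rightarrow> nat \<Rightarrow> nat) \<Rightarrow> bool" where
  "root_n_rate_if_fixed M T p x \<longleftrightarrow>
     (T p = p \<longrightarrow>
        (\<forall>k. 2 \<le> k \<longrightarrow>
           bigO_prob M (\<lambda>n \<omega>. sqrt (real n) * lnorm k (\<lambda>j. T (emp n (x n \<omega>)) j - p j)) 0) \<and>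
        (summable (\<lambda>j. sqrt (p j)) \<longrightarrow>
           bigO_prob M (\<lambda>n \<omega>. sqrt (real n) * lnorm 1 (\<lambda>j. T (emp n (x n \<omega>)) j - p j)) 0))"

end

theory Submission
  imports Defs "HOL-Real_Asymp.Real_Asymp"
begin

text \<open>
  The projection is first taken onto the convex cone of nonnegative isotonic square-summable
  sequences.  Its variational inequality gives monotonicity, the sup-norm contraction and
  homogeneity.  Testing it with indicators of finite up-sets and with truncations \<open>min u e\<close> shows
  that it preserves sums, so it maps probability vectors to probability vectors and agrees with
  the isotonic regression; together with monotonicity this also gives the \<open>\<ell>\<^sub>1\<close> contraction.

  If \<open>T p = p\<close>, the estimator is a convex combination of two vectors that are no farther from \<open>p\<close>
  than the empirical distribution.  Otherwise \<open>\<langle>p, p - T p\<rangle> = \<parallel>p - T p\<parallel>\<^sup>2 > 0\<close>, and whenever the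
  empirical distribution is \<open>\<ell>\<^sub>1\<close>-close to \<open>p\<close> the mixture parameter is \<open>0\<close> for the loss \<open>L\<^sub>1\<close> and
  \<open>O(1/n)\<close> for the loss \<open>L\<^sub>2\<close>.  So the error exceeds a constant multiple of that of the empirical
  distribution by at most \<open>O(1/n)\<close>.
\<close>

subsection \<open>Square-summable sequences\<close>

text \<open>Normalisation is dropped because total mass 1 survives neither scaling nor shifted
  minima and maxima, and coordinatewise limits can lose mass. Recovering it afterwards is where
  finiteness of the principal up-sets enters: the indicator of an up-set is an admissible test
  vector only if it is square-summable. When \<open>T p\<close> differs from \<open>p\<close>, the
  gap between them is a fixed positive number, whereas deleting one observation moves any fitted
  coordinate by at most \<open>1 / (n - 1)\<close>, by the sup-norm contraction. Hence the
  cross-validation criteria are eventually decided by that gap: \<open>b_n\<close> is at most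
  \<open>2 n^2\<close> while \<open>a_n\<close> grows like \<open>n^3\<close>. All of this is
  deterministic and uniform over \<open>freq_data\<close>. Randomness enters only through the
  empirical distribution: almost sure \<open>\<ell>\<^sub>1\<close> convergence, and the
  coordinatewise variance bound \<open>p j / n\<close>. The latter sums to \<open>1 / n\<close>, and
  its square roots sum to a multiple of \<open>1 / sqrt n\<close> exactly under the extra hypothesis
  of the \<open>\<ell>\<^sub>1\<close> rate.\<close>

definition sqsum :: "(nat \<Rightarrow> real) \<Rightarrow> bool" where
  "sqsum f \<longleftrightarrow> summable (\<lambda>j. (f j)\<^sup>2)"

lemma sqsum_mono:
  assumes "sqsum g" "\<And>j. \<bar>f j\<bar> \<le> \<bar>g j\<bar>"
  shows "sqsum f"
  unfolding sqsum_def
  by (rule summable_comparison_test'[OF assms(1)[unfolded sqsum_def], of 0])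
     (use assms(2) in \<open>simp add: abs_le_square_iff\<close>)

lemma summable_mult_sqsum:
  assumes "sqsum f" "sqsum g"
  shows "summable (\<lambda>j. f j * g j)"
proof (rule summable_comparison_test'[of "\<lambda>j. (f j)\<^sup>2 + (g j)\<^sup>2" 0])
  show "summable (\<lambda>j. (f j)\<^sup>2 + (g j)\<^sup>2)"
    using assms by (auto simp: sqsum_def intro: summable_add)
  have *: "\<bar>x * y\<bar> \<le> x\<^sup>2 + y\<^sup>2" for x y :: real
    using sum_squares_bound[of "\<bar>x\<bar>" "\<bar>y\<bar>"] mult_nonneg_nonneg[of "\<bar>x\<bar>" "\<bar>y\<bar>"]
    unfolding abs_mult power2_abs by linarith
  show "norm (f j * g j) \<le> (f j)\<^sup>2 + (g j)\<^sup>2" for j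
    unfolding real_norm_def by (rule *)
qed

lemma sqsum_add:
  assumes "sqsum f" "sqsum g"
  shows "sqsum (\<lambda>j. f j + g j)"
proof -
  have "summable (\<lambda>j. (f j)\<^sup>2 + (g j)\<^sup>2 + 2 * (f j * g j))"
    using assms summable_mult_sqsum[OF assms]
    by (intro summable_add summable_mult) (auto simp: sqsum_def)
  then show ?thesis by (simp add: sqsum_def power2_sum algebra_simps)
qed

lemma sqsum_cmult: "sqsum f \<Longrightarrow> sqsum (\<lambda>j. c * f j)"
  by (auto simp: sqsum_def power_mult_distrib intro: summable_mult)

lemma sqsum_diff:
  assumes "sqsum f" "sqsum g"
  shows "sqsum (\<lambda>j. f j - g j)"
  using sqsum_add[OF assms(1) sqsum_cmult[OF assms(2), of "-1"]] by simp

lemma summable_imp_sqsum: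
  assumes "summable (\<lambda>j. \<bar>f j\<bar>)"
  shows "sqsum f"
  unfolding sqsum_def
proof (rule summable_comparison_test'[OF summable_mult[OF assms], of 0])
  fix j
  have "\<bar>f j\<bar> \<le> (\<Sum>j. \<bar>f j\<bar>)"
    using sum_le_suminf[OF assms, of "{j}"] by simp
  then show "norm ((f j)\<^sup>2) \<le> (\<Sum>j. \<bar>f j\<bar>) * \<bar>f j\<bar>"
    using mult_right_mono[of "\<bar>f j\<bar>" _ "\<bar>f j\<bar>"] by (simp add: power2_eq_square)
qed

lemma l2_inner_diff_left:
  assumes "sqsum f" "sqsum g" "sqsum h"
  shows "l2_inner (\<lambda>j. f j - g j) h = l2_inner f h - l2_inner g h"
  unfolding l2_inner_def left_diff_distrib
  by (rule suminf_diff[symmetric]) (simp_all add: assms summable_mult_sqsum)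

lemma l2_inner_commute: "l2_inner f g = l2_inner g f"
  by (simp add: l2_inner_def mult.commute)

lemma l2_inner_diff_right:
  assumes "sqsum f" "sqsum g" "sqsum h"
  shows "l2_inner h (\<lambda>j. f j - g j) = l2_inner h f - l2_inner h g"
  using l2_inner_diff_left[OF assms] by (simp add: l2_inner_commute)

lemma l2_inner_cmult_right:
  assumes "sqsum f" "sqsum g"
  shows "l2_inner f (\<lambda>j. c * g j) = c * l2_inner f g"
  using suminf_mult[OF summable_mult_sqsum[OF assms], of c]
  by (simp add: l2_inner_def algebra_simps)

lemma l2_inner_cmult_left:
  assumes "sqsum f" "sqsum g"
  shows "l2_inner (\<lambda>j. c * f j) g = c * l2_inner f g"
  using l2_inner_cmult_right[OF assms(2,1)] by (simp add: l2_inner_commute)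

lemma l2_inner_nonneg:
  assumes "sqsum f" "sqsum g" "\<And>j. 0 \<le> f j * g j"
  shows "0 \<le> l2_inner f g"
  unfolding l2_inner_def by (rule suminf_nonneg) (use assms summable_mult_sqsum in auto)

lemma l2_inner_self_nonneg: "sqsum f \<Longrightarrow> 0 \<le> l2_inner f f"
  by (rule l2_inner_nonneg) auto

lemma l2_inner_self: "l2_inner f f = (\<Sum>j. (f j)\<^sup>2)"
  by (simp add: l2_inner_def power2_eq_square)

lemma sq_dist_eq: "sq_dist g f = l2_inner (\<lambda>j. f j - g j) (\<lambda>j. f j - g j)"
  by (simp add: l2_inner_self sq_dist_def)

lemma sq_dist_expand:
  assumes [simp]: "sqsum g" "sqsum u" "sqsum w"
  shows "sq_dist g w = sq_dist g u - 2 * l2_inner (\<lambda>j. g j - u j) (\<lambda>j. w j - u j)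
           + l2_inner (\<lambda>j. w j - u j) (\<lambda>j. w j - u j)"
  by (simp add: sq_dist_eq l2_inner_diff_left l2_inner_diff_right sqsum_diff
      l2_inner_commute[of w g] l2_inner_commute[of w u] l2_inner_commute[of u g])

lemma l2_inner_self_eq_0:
  assumes "sqsum f" "l2_inner f f \<le> 0"
  shows "f j = 0"
  using assms suminf_eq_zero_iff[of "\<lambda>j. (f j)\<^sup>2"] suminf_nonneg[of "\<lambda>j. (f j)\<^sup>2"]
  by (auto simp: l2_inner_self sqsum_def)

subsection \<open>Projection onto the cone of isotonic sequences\<close>

locale finite_upset_preorder =
  fixes J :: "nat set" and le :: "nat \<Rightarrow> nat \<Rightarrow> bool"
  assumes le_refl: "i \<in> J \<Longrightarrow> le i i"
    and le_trans: "i \<in> J \<Longrightarrow> j \<in> J \<Longrightarrow> k \<in> J \<Longrightarrow> le i j \<Longrightarrow> le j k \<Longrightarrow> le i k"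
    and finite_upset: "i \<in> J \<Longrightarrow> finite {j \<in> J. le i j}"
begin

text \<open>Without a constraint on the total mass the set is closed under sums, nonnegative
  multiples and the shifted minima and maxima below, which are all the perturbations that the
  variational inequality is tested with.\<close>

definition cone :: "(nat \<Rightarrow> real) set" where
  "cone = {f. (\<forall>j. 0 \<le> f j) \<and> (\<forall>j. j \<notin> J \<longrightarrow> f j = 0) \<and> sqsum f \<and>
             (\<forall>i\<in>J. \<forall>j\<in>J. le i j \<longrightarrow> f i \<le> f j)}"

text \<open>The variational inequality that characterises the metric projection onto a convex set.\<close>

definition is_proj :: "(nat \<Rightarrow> real) \<Rightarrow> (nat \<Rightarrow> real) \<Rightarrow> bool" where
  "is_proj g u \<longleftrightarrow> u \<in> cone \<and>
     (\<forall>w\<in>cone. l2_inner (\<lambda>j. g j - u j) (\<lambda>j. w j - u j) \<le> 0)"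

lemma is_projD:
  assumes "is_proj g u" "w \<in> cone"
  shows "l2_inner (\<lambda>j. g j - u j) (\<lambda>j. w j - u j) \<le> 0"
  using assms by (simp add: is_proj_def)

lemma zero_in_cone: "(\<lambda>_. 0) \<in> cone"
  by (simp add: cone_def sqsum_def)

lemma cone_sqsum: "f \<in> cone \<Longrightarrow> sqsum f"
  by (simp add: cone_def)

lemma cone_nonneg: "f \<in> cone \<Longrightarrow> 0 \<le> f j"
  by (simp add: cone_def)

lemma cone_add: "f \<in> cone \<Longrightarrow> g \<in> cone \<Longrightarrow> (\<lambda>j. f j + g j) \<in> cone"
  by (auto simp: cone_def intro: sqsum_add add_mono)

lemma cone_cmult: "f \<in> cone \<Longrightarrow> 0 \<le> c \<Longrightarrow> (\<lambda>j. c * f j) \<in> cone"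
  by (auto simp: cone_def intro: sqsum_cmult mult_left_mono)

text \<open>The constant \<open>c\<close> is not square-summable, but the minimum lies between
  \<open>0\<close> and \<open>u\<close>; outside \<open>J\<close> it is
  \<open>min 0 c = 0\<close>.\<close>

lemma cone_min_shift:
  assumes "u \<in> cone" "v \<in> cone" "0 \<le> c"
  shows "(\<lambda>j. min (u j) (v j + c)) \<in> cone"
proof -
  have "sqsum (\<lambda>j. min (u j) (v j + c))"
  proof (rule sqsum_mono[OF cone_sqsum[OF assms(1)]])
    show "\<bar>min (u j) (v j + c)\<bar> \<le> \<bar>u j\<bar>" for j
      using cone_nonneg[OF assms(1), of j] cone_nonneg[OF assms(2), of j] assms(3) by linarith
  qed
  moreover have "min (u i) (v i + c) \<le> min (u j) (v j + c)" if "i \<in> J" "j \<in> J" "le i j" for i j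
    using that assms by (intro min.mono add_right_mono) (auto simp: cone_def)
  ultimately show ?thesis using assms by (auto simp: cone_def)
qed

text \<open>Here \<open>v\<close> keeps the maximum nonnegative and \<open>u + v\<close> dominates
  it.\<close>

lemma cone_max_shift:
  assumes "u \<in> cone" "v \<in> cone" "0 \<le> c"
  shows "(\<lambda>j. max (v j) (u j - c)) \<in> cone"
proof -
  have "sqsum (\<lambda>j. max (v j) (u j - c))"
  proof (rule sqsum_mono[OF sqsum_add[OF cone_sqsum[OF assms(1)] cone_sqsum[OF assms(2)]]])
    show "\<bar>max (v j) (u j - c)\<bar> \<le> \<bar>u j + v j\<bar>" for j
      using cone_nonneg[OF assms(1), of j] cone_nonneg[OF assms(2), of j] assms(3) by linarith
  qed
  moreover have "max (v i) (u i - c) \<le> max (v j) (u j - c)" if "i \<in> J" "j \<in> J" "le i j" for i j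
    using that assms by (intro max.mono diff_right_mono) (auto simp: cone_def)
  ultimately show ?thesis using assms by (auto simp: cone_def le_max_iff_disj)
qed

section \<open>Existence of the metric projection\<close>

lemma compact_box: "compact (PiE UNIV (\<lambda>j. {0..b j}))" for b :: "nat \<Rightarrow> real"
proof -
  have "compactin (product_topology (\<lambda>_. euclidean) UNIV) (PiE UNIV (\<lambda>j. {0..b j}))"
    by (simp add: compactin_PiE)
  then show ?thesis by (simp add: euclidean_product_topology)
qed

text \<open>Compactness for coordinatewise convergence takes the place of completeness of the
  sequence space: the near-minimisers form nested closed sets that all meet one compact box, and a
  common point attains the infimum because partial sums bound the whole series.\<close>

lemma ex_minimiser:
  assumes g: "sqsum g"
  shows "\<exists>u\<in>cone. \<forall>w\<in>cone. sq_dist g u \<le> sq_dist g w"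
proof -
  define m where "m = (INF w\<in>cone. sq_dist g w)"
  have nn: "0 \<le> sq_dist g w" if "w \<in> cone" for w
    unfolding sq_dist_eq by (intro l2_inner_self_nonneg sqsum_diff cone_sqsum that g)
  have m_le: "m \<le> sq_dist g w" if "w \<in> cone" for w
    unfolding m_def using nn that by (intro cINF_lower bdd_belowI2[of _ 0]) auto
  have m0: "0 \<le> m" unfolding m_def using zero_in_cone nn by (intro cINF_greatest) auto
  \<comment> \<open>Near-minimality is phrased with finite partial sums, each depending on finitely
    many coordinates, so that \<open>P n\<close> is closed coordinatewise. Nonnegativity is supplied
    by the box \<open>B\<close>.\<close>
  define P where "P n = {f. (\<forall>j. j \<notin> J \<longrightarrow> f j = 0) \<and> (\<forall>i\<in>J. \<forall>j\<in>J. le i j \<longrightarrow> f i \<le> f j) \<and>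
      (\<forall>N. (\<Sum>j<N. (f j - g j)\<^sup>2) \<le> m + 1 / real (Suc n))}" for n
  \<comment> \<open>A near-minimiser satisfies \<open>(w j - g j)^2 \<le> m + 1\<close>, and
    \<open>\<bar>y\<bar> \<le> y^2 + 1\<close> turns this into the radius
    \<open>m + 2\<close>.\<close>
  define B where "B = PiE UNIV (\<lambda>j. {0..\<bar>g j\<bar> + m + 2})"
  have mono_P: "P n \<subseteq> P k" if "k \<le> n" for k n
  proof -
    have "1 / real (Suc n) \<le> 1 / real (Suc k)" using that by (simp add: frac_le)
    then show ?thesis unfolding P_def by (auto intro: order_trans)
  qed
  have closed_P: "closed (P n)" for n
  proof -
    have c: "continuous_on UNIV (\<lambda>f :: nat \<Rightarrow> real. f j)" for j by simp
    have 1: "closed {f :: nat \<Rightarrow> real. j \<notin> J \<longrightarrow> f j = 0}" for j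
      by (cases "j \<in> J") (auto intro!: closed_Collect_eq)
    have 2: "closed {f :: nat \<Rightarrow> real. le i j \<longrightarrow> f i \<le> f j}" for i j
      by (cases "le i j") (auto intro!: closed_Collect_le)
    have 3: "closed {f :: nat \<Rightarrow> real. (\<Sum>j<N. (f j - g j)\<^sup>2) \<le> m + 1 / real (Suc n)}" for N
      by (intro closed_Collect_le continuous_intros c)
    have 4: "P n = (\<Inter>j. {f. j \<notin> J \<longrightarrow> f j = 0}) \<inter> (\<Inter>i\<in>J. \<Inter>j\<in>J. {f. le i j \<longrightarrow> f i \<le> f j}) \<inter>
        (\<Inter>N. {f. (\<Sum>j<N. (f j - g j)\<^sup>2) \<le> m + 1 / real (Suc n)})"
      unfolding P_def by auto
    show ?thesis unfolding 4 by (intro closed_Int closed_INT ballI 1 2 3)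
  qed
  have ne: "B \<inter> P n \<noteq> {}" for n
  proof -
    have "(INF w\<in>cone. sq_dist g w) < m + 1 / real (Suc n)" unfolding m_def by simp
    then obtain w where w: "w \<in> cone" "sq_dist g w < m + 1 / real (Suc n)"
      using zero_in_cone nn by (subst (asm) cINF_less_iff) (auto intro!: bdd_belowI2[of _ 0])
    have sm: "summable (\<lambda>j. (w j - g j)\<^sup>2)"
      using sqsum_diff[OF cone_sqsum[OF w(1)] g] by (simp add: sqsum_def)
    have fin: "sum (\<lambda>j. (w j - g j)\<^sup>2) I \<le> m + 1 / real (Suc n)" if "finite I" for I
      using sum_le_suminf[OF sm that] w(2) by (simp add: sq_dist_def)
    have "0 \<le> w j \<and> w j \<le> \<bar>g j\<bar> + m + 2" for j
    proof -
      have "(w j - g j)\<^sup>2 \<le> m + 1" using fin[of "{j}"] by (simp add: order_trans)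
      moreover have "\<bar>y\<bar> \<le> y\<^sup>2 + 1" for y :: real
        using zero_le_power2[of "\<bar>y\<bar> - 1"] by (simp add: power2_diff)
      ultimately have "\<bar>w j - g j\<bar> \<le> m + 2" by (smt (verit))
      then show ?thesis using cone_nonneg[OF w(1), of j] by linarith
    qed
    then have "w \<in> B" by (auto simp: B_def)
    moreover have "w \<in> P n" using w(1) fin by (auto simp: P_def cone_def)
    ultimately show ?thesis by blast
  qed
  have "B \<inter> \<Inter>(range P) \<noteq> {}"
  proof (rule compact_imp_fip_image)
    show "compact B" unfolding B_def by (rule compact_box)
    show "closed (P i)" for i by (rule closed_P)
    fix I :: "nat set" assume I: "finite I"
    have "P (Max (insert 0 I)) \<subseteq> P i" if "i \<in> I" for i
      by (rule mono_P) (use I that in simp)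
    then have "P (Max (insert 0 I)) \<subseteq> \<Inter>(P ` I)" by blast
    then show "B \<inter> \<Inter>(P ` I) \<noteq> {}" using ne by blast
  qed
  then obtain u where u: "u \<in> B" "\<And>n. u \<in> P n" by blast
  have le_m: "(\<Sum>j<N. (u j - g j)\<^sup>2) \<le> m" for N
  proof (rule LIMSEQ_le_const)
    show "(\<lambda>n. m + 1 / real (Suc n)) \<longlonglongrightarrow> m"
      using tendsto_add[OF tendsto_const[of m] LIMSEQ_inverse_real_of_nat] by (simp add: inverse_eq_divide)
    show "\<exists>N'. \<forall>n\<ge>N'. (\<Sum>j<N. (u j - g j)\<^sup>2) \<le> m + 1 / real (Suc n)"
      using u(2) by (auto simp: P_def)
  qed
  have sm: "summable (\<lambda>j. (u j - g j)\<^sup>2)"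
    by (rule summableI_nonneg_bounded[OF _ le_m]) auto
  then have "sqsum (\<lambda>j. (u j - g j) + g j)"
    by (intro sqsum_add g) (simp add: sqsum_def)
  then have "u \<in> cone" using u by (auto simp: cone_def B_def P_def PiE_iff)
  moreover have "sq_dist g u \<le> m"
    unfolding sq_dist_def by (rule suminf_le_const[OF sm le_m])
  ultimately show ?thesis using m_le by force
qed

text \<open>First-order optimality along the segment from the minimiser \<open>u\<close> to
  \<open>w\<close>: minimality at parameter \<open>t\<close> gives \<open>2 * A \<le> t * D\<close>,
  and \<open>t\<close> tends to \<open>0\<close>.\<close>

lemma ex_is_proj:
  assumes g: "sqsum g"
  shows "\<exists>u. is_proj g u"
proof -
  obtain u where u: "u \<in> cone" and min: "\<And>w. w \<in> cone \<Longrightarrow> sq_dist g u \<le> sq_dist g w"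
    using ex_minimiser[OF g] by blast
  note [simp] = g cone_sqsum
  have "l2_inner (\<lambda>j. g j - u j) (\<lambda>j. w j - u j) \<le> 0" if w: "w \<in> cone" for w
  proof -
    define A where "A = l2_inner (\<lambda>j. g j - u j) (\<lambda>j. w j - u j)"
    define D where "D = l2_inner (\<lambda>j. w j - u j) (\<lambda>j. w j - u j)"
    have le: "2 * A \<le> t * D" if t: "0 < t" "t \<le> 1" for t
    proof -
      define v where "v = (\<lambda>j. (1 - t) * u j + t * w j)"
      have v: "v \<in> cone" unfolding v_def using t by (intro cone_add cone_cmult u w) auto
      have vu: "(\<lambda>j. v j - u j) = (\<lambda>j. t * (w j - u j))" by (auto simp: v_def algebra_simps)
      have "sq_dist g v = sq_dist g u - 2 * (t * A) + t * (t * D)"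
        using u v w unfolding A_def D_def
        by (subst sq_dist_expand[of g u v])
           (simp_all add: vu l2_inner_cmult_left l2_inner_cmult_right sqsum_diff sqsum_cmult)
      then have "t * (2 * A) \<le> t * (t * D)" using min[OF v] by simp
      then show ?thesis using t by simp
    qed
    have "2 * A \<le> 0"
    proof (rule tendsto_lowerbound)
      show "((\<lambda>t. t * D) \<longlongrightarrow> 0) (at_right 0)"
        by (rule tendsto_eq_intros | simp)+
      show "\<forall>\<^sub>F t in at_right 0. 2 * A \<le> t * D"
        unfolding eventually_at_right_field by (rule exI[of _ 1]) (use le in auto)
    qed simp
    then show ?thesis by (simp add: A_def)
  qed
  with u show ?thesis by (auto simp: is_proj_def)
qed

text \<open>Test the two variational inequalities against \<open>min u (v + c)\<close> and \<open>max v (u - c)\<close>, which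
  arise from \<open>u\<close> and \<open>v\<close> by moving the excess \<open>(u - v - c)\<^sup>+\<close> from one to the other.\<close>

lemma is_proj_mono_shift:
  assumes f: "sqsum f" "is_proj f u" and h: "sqsum h" "is_proj h v"
    and c: "0 \<le> c" and fh: "\<And>j. f j \<le> h j + c"
  shows "u j \<le> v j + c"
proof -
  have u: "u \<in> cone" and v: "v \<in> cone" using f h by (auto simp: is_proj_def)
  note [simp] = f(1) h(1) cone_sqsum[OF u] cone_sqsum[OF v]
  define w where "w = (\<lambda>j. max 0 (u j - v j - c))"
  have w: "sqsum w"
  proof (rule sqsum_mono[OF cone_sqsum[OF u]])
    show "\<bar>w j\<bar> \<le> \<bar>u j\<bar>" for j
      unfolding w_def using cone_nonneg[OF u, of j] cone_nonneg[OF v, of j] c by linarith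
  qed
  have "l2_inner (\<lambda>j. f j - u j) (\<lambda>j. min (u j) (v j + c) - u j) \<le> 0"
    by (rule is_projD[OF f(2) cone_min_shift[OF u v c]])
  moreover have "(\<lambda>j. min (u j) (v j + c) - u j) = (\<lambda>j. (-1) * w j)"
    by (auto simp: w_def)
  ultimately have 1: "0 \<le> l2_inner (\<lambda>j. f j - u j) w"
    using l2_inner_cmult_right[of "\<lambda>j. f j - u j" w "-1"] w by (simp add: sqsum_diff)
  have "l2_inner (\<lambda>j. h j - v j) (\<lambda>j. max (v j) (u j - c) - v j) \<le> 0"
    by (rule is_projD[OF h(2) cone_max_shift[OF u v c]])
  moreover have "(\<lambda>j. max (v j) (u j - c) - v j) = w"
    by (auto simp: w_def)
  ultimately have 2: "l2_inner (\<lambda>j. h j - v j) w \<le> 0" by simp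
  define e where "e = (\<lambda>j. (h j - v j) - (f j - u j))"
  have e: "sqsum e" unfolding e_def by (simp add: sqsum_diff)
  have 3: "l2_inner e w \<le> 0"
    using 1 2 unfolding e_def by (simp add: l2_inner_diff_left w sqsum_diff)
  \<comment> \<open>Where \<open>w i > 0\<close>, \<open>e i\<close> equals \<open>w i\<close> plus
    the nonnegative slack \<open>h i + c - f i\<close>; elsewhere both sides vanish.\<close>
  have "w i * w i \<le> e i * w i" for i
    unfolding e_def w_def using fh[of i] by (auto simp: max_def intro!: mult_right_mono)
  then have "l2_inner w w \<le> l2_inner e w"
    unfolding l2_inner_def by (intro suminf_le summable_mult_sqsum w e)
  then have "w j = 0" using l2_inner_self_eq_0[OF w] 3 by simp
  then show ?thesis by (simp add: w_def max_def split: if_splits)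
qed

lemma is_proj_mono:
  assumes "sqsum f" "is_proj f u" "sqsum h" "is_proj h v" "\<And>j. f j \<le> h j"
  shows "u j \<le> v j"
  using is_proj_mono_shift[OF assms(1-4), of 0] assms(5) by simp

text \<open>Needed with \<open>c = 1 - 1 / n\<close>, which takes a leave-one-out vector out of the
  probability vectors but not out of the scope of the cone projection.\<close>

lemma is_proj_cmult:
  assumes "sqsum g" "is_proj g u" "0 < c"
  shows "is_proj (\<lambda>j. c * g j) (\<lambda>j. c * u j)"
  unfolding is_proj_def
proof (intro conjI ballI)
  have u: "u \<in> cone" using assms by (simp add: is_proj_def)
  show "(\<lambda>j. c * u j) \<in> cone" using u assms by (intro cone_cmult) auto
  fix w assume w: "w \<in> cone"
  define w' where "w' = (\<lambda>j. inverse c * w j)"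
  have w': "w' \<in> cone" unfolding w'_def using w assms by (intro cone_cmult) auto
  have "w j = c * w' j" for j using assms by (simp add: w'_def)
  then have "l2_inner (\<lambda>j. c * g j - c * u j) (\<lambda>j. w j - c * u j)
      = l2_inner (\<lambda>j. c * (g j - u j)) (\<lambda>j. c * (w' j - u j))"
    by (simp add: right_diff_distrib)
  also have "\<dots> = c * (c * l2_inner (\<lambda>j. g j - u j) (\<lambda>j. w' j - u j))"
    using assms u w'
    by (simp add: l2_inner_cmult_left l2_inner_cmult_right sqsum_diff cone_sqsum sqsum_cmult)
  also have "\<dots> \<le> 0"
    using assms is_projD[OF assms(2) w'] by (auto intro!: mult_nonneg_nonpos)
  finally show "l2_inner (\<lambda>j. c * g j - c * u j) (\<lambda>j. w j - c * u j) \<le> 0" .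
qed

text \<open>The ray through \<open>u\<close> stays in the cone; testing with its points
  \<open>2 * u\<close> and \<open>0\<close> gives both signs.\<close>

lemma is_proj_orthogonal:
  assumes "sqsum g" "is_proj g u"
  shows "l2_inner u (\<lambda>j. g j - u j) = 0"
proof -
  have u: "u \<in> cone" using assms by (simp add: is_proj_def)
  have "l2_inner (\<lambda>j. g j - u j) (\<lambda>j. 2 * u j - u j) \<le> 0"
    using is_projD[OF assms(2) cone_cmult[OF u, of 2]] by simp
  moreover have "l2_inner (\<lambda>j. g j - u j) (\<lambda>j. 0 - u j) \<le> 0"
    by (rule is_projD[OF assms(2) zero_in_cone])
  then have "l2_inner (\<lambda>j. g j - u j) (\<lambda>j. (-1) * u j) \<le> 0" by simp
  then have "0 \<le> l2_inner (\<lambda>j. g j - u j) u"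
    using l2_inner_cmult_right[of "\<lambda>j. g j - u j" u "-1"] assms u
    by (simp add: sqsum_diff cone_sqsum)
  ultimately show ?thesis by (simp add: l2_inner_commute)
qed

lemma is_proj_residual:
  assumes "sqsum g" "is_proj g u"
  shows "l2_inner g (\<lambda>j. g j - u j) = sq_dist g u"
proof -
  have u: "u \<in> cone" using assms by (simp add: is_proj_def)
  have "l2_inner (\<lambda>j. g j - u j) (\<lambda>j. g j - u j) = l2_inner g (\<lambda>j. g j - u j) - l2_inner u (\<lambda>j. g j - u j)"
    by (simp add: l2_inner_diff_left assms u cone_sqsum sqsum_diff)
  then show ?thesis using is_proj_orthogonal[OF assms]
    by (simp add: sq_dist_eq l2_inner_self power2_commute)
qed

text \<open>Each variational inequality is tested with the other projection. Their sum bounds the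
  squared norm of \<open>b\<close> by the inner product of \<open>a\<close> and \<open>b\<close>,
  and expanding the square of \<open>a - b\<close> does the work of Cauchy-Schwarz.\<close>

lemma is_proj_l2_contraction:
  assumes f: "sqsum f" "is_proj f u" and h: "sqsum h" "is_proj h v"
  shows "sq_dist v u \<le> sq_dist h f"
proof -
  have u: "u \<in> cone" and v: "v \<in> cone" using f h by (auto simp: is_proj_def)
  note [simp] = f(1) h(1) cone_sqsum[OF u] cone_sqsum[OF v]
  define a where "a = (\<lambda>j. f j - h j)"
  define b where "b = (\<lambda>j. u j - v j)"
  have [simp]: "sqsum a" "sqsum b" by (simp_all add: a_def b_def sqsum_diff)
  have "l2_inner (\<lambda>j. f j - u j) (\<lambda>j. v j - u j) + l2_inner (\<lambda>j. h j - v j) (\<lambda>j. u j - v j) \<le> 0"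
    by (intro add_nonpos_nonpos is_projD f h u v)
  then have "l2_inner b b \<le> l2_inner a b"
    by (simp add: a_def b_def l2_inner_diff_left l2_inner_diff_right sqsum_diff)
  moreover have "0 \<le> l2_inner (\<lambda>j. a j - b j) (\<lambda>j. a j - b j)"
    by (intro l2_inner_self_nonneg sqsum_diff) auto
  then have "2 * l2_inner a b \<le> l2_inner a a + l2_inner b b"
    by (simp add: l2_inner_diff_left l2_inner_diff_right sqsum_diff l2_inner_commute[of b a])
  ultimately show ?thesis by (simp add: sq_dist_eq a_def b_def)
qed

section \<open>Preservation of the total mass and the \<open>\<ell>\<^sub>1\<close>
  contraction\<close>

definition upset_below :: "nat \<Rightarrow> nat set" where
  "upset_below N = {j \<in> J. \<exists>i\<in>J. i < N \<and> le i j}"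

lemma finite_upset_below: "finite (upset_below N)"
proof -
  have "upset_below N \<subseteq> (\<Union>i\<in>{i\<in>J. i < N}. {j\<in>J. le i j})" by (auto simp: upset_below_def)
  moreover have "finite \<dots>" using finite_upset by auto
  ultimately show ?thesis by (rule finite_subset)
qed

lemma indicator_upset_below_in_cone: "indicator (upset_below N) \<in> cone"
proof -
  have "sqsum (indicator (upset_below N))"
    unfolding sqsum_def by (rule summable_finite[OF finite_upset_below[of N]]) auto
  then show ?thesis
    unfolding cone_def by (auto simp: indicator_def upset_below_def intro: le_trans)
qed

text \<open>No mass is created (\<open>upper\<close>), because \<open>u\<close> may be lowered by a
  small truncation; none is lost (\<open>lower\<close>), because \<open>u\<close> may be raised on a
  finite up-set.\<close>

lemma is_proj_sums:
  assumes nn: "\<And>j. 0 \<le> g j" and supp: "\<And>j. j \<notin> J \<Longrightarrow> g j = 0" and sm: "summable g"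
    and proj: "is_proj g u"
  shows "u sums (\<Sum>j. g j)"
proof -
  have g: "sqsum g" by (rule summable_imp_sqsum) (use nn sm in simp)
  have u: "u \<in> cone" using proj by (simp add: is_proj_def)
  note u0 = cone_nonneg[OF u]
  note [simp] = g cone_sqsum[OF u]
  have upper: "sum u I \<le> (\<Sum>j. g j)" if I: "finite I" for I
  proof -
    define A where "A = {j\<in>I. 0 < u j}"
    \<comment> \<open>Small enough that the truncation \<open>min (u j) e\<close> equals
      \<open>e\<close> at every positive coordinate in \<open>I\<close>; the inserted
      \<open>1\<close> keeps \<open>Min\<close> meaningful when there is none.\<close>
    define e where "e = Min (insert 1 (u ` A))"
    have A: "finite A" using I by (simp add: A_def)
    have e: "0 < e" "\<And>j. j \<in> A \<Longrightarrow> e \<le> u j" using A by (auto simp: e_def A_def)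
    define w where "w = (\<lambda>j. min (u j) e)"
    \<comment> \<open>Subtracting an indicator from \<open>u\<close> could break isotonicity or
      nonnegativity, whereas \<open>max 0 (u - e) = u - min u e\<close> stays in the cone. Then
      \<open>e\<close> times the sum of \<open>u\<close> over \<open>I\<close> is at most the inner
      product of \<open>u\<close> and \<open>w\<close>, hence of \<open>g\<close> and
      \<open>w\<close>, hence \<open>e\<close> times the sum of \<open>g\<close>.\<close>
    have ww: "(\<lambda>j. max 0 (u j - e)) \<in> cone"
      using cone_max_shift[OF u zero_in_cone, of e] e by simp
    have [simp]: "sqsum w"
      by (rule sqsum_mono[OF cone_sqsum[OF u]]) (use u0 e in \<open>auto simp: w_def\<close>)
    have "l2_inner (\<lambda>j. g j - u j) (\<lambda>j. max 0 (u j - e) - u j) \<le> 0"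
      by (rule is_projD[OF proj ww])
    moreover have "(\<lambda>j. max 0 (u j - e) - u j) = (\<lambda>j. (-1) * w j)" by (auto simp: w_def)
    ultimately have "0 \<le> l2_inner (\<lambda>j. g j - u j) w"
      using l2_inner_cmult_right[of "\<lambda>j. g j - u j" w "-1"] by (simp add: sqsum_diff)
    then have "l2_inner u w \<le> l2_inner g w" by (simp add: l2_inner_diff_left)
    also have "\<dots> \<le> (\<Sum>j. e * g j)"
      unfolding l2_inner_def
    proof (intro suminf_le summable_mult sm)
      show "summable (\<lambda>j. g j * w j)" by (rule summable_mult_sqsum) simp_all
      show "g j * w j \<le> e * g j" for j
        using nn[of j] mult_left_mono[of "w j" e "g j"] by (simp add: w_def mult.commute)
    qed
    also have "\<dots> = e * (\<Sum>j. g j)" by (rule suminf_mult[OF sm])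
    finally have 1: "l2_inner u w \<le> e * (\<Sum>j. g j)" .
    have "e * sum u I = (\<Sum>j\<in>A. u j * e)"
      unfolding sum_distrib_left A_def using I u0
      by (intro sum.mono_neutral_cong_right) (auto simp: not_less order_antisym)
    also have "\<dots> = (\<Sum>j\<in>A. u j * w j)" using e by (intro sum.cong) (auto simp: w_def)
    also have "\<dots> \<le> l2_inner u w"
      unfolding l2_inner_def
    proof (intro sum_le_suminf A)
      show "summable (\<lambda>j. u j * w j)" by (rule summable_mult_sqsum) simp_all
      show "0 \<le> u j * w j" for j using u0[of j] e(1) by (simp add: w_def)
    qed
    also note 1
    finally show ?thesis using e(1) by (rule mult_left_le_imp_le)
  qed
  have smu: "summable u" by (rule summableI_nonneg_bounded[OF u0 upper]) simp
  \<comment> \<open>The generated up-set contains every index of \<open>J\<close> below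
    \<open>N\<close>, so it captures the partial sum of \<open>g\<close>, and its indicator may be
    added to \<open>u\<close> within the cone.\<close>
  have lower: "(\<Sum>j<N. g j) \<le> (\<Sum>j. u j)" for N
  proof -
    define U where "U = upset_below N"
    have U: "finite U" by (simp add: U_def finite_upset_below)
    have [simp]: "sqsum (indicator U)"
      unfolding U_def by (rule cone_sqsum[OF indicator_upset_below_in_cone])
    have "l2_inner (\<lambda>j. g j - u j) (\<lambda>j. (u j + indicator U j) - u j) \<le> 0"
      unfolding U_def by (rule is_projD[OF proj cone_add[OF u indicator_upset_below_in_cone]])
    then have "l2_inner g (indicator U) \<le> l2_inner u (indicator U)"
      by (simp add: l2_inner_diff_left)
    moreover have "l2_inner f (indicator U) = sum f U" for f
      unfolding l2_inner_def by (subst suminf_finite[OF U]) (auto intro!: sum.cong)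
    ultimately have 1: "sum g U \<le> sum u U" by simp
    have "(\<Sum>j<N. g j) = sum g {j\<in>J. j < N}"
      by (intro sum.mono_neutral_right) (use supp in auto)
    also have "\<dots> \<le> sum g U"
      using U nn by (intro sum_mono2) (auto simp: U_def upset_below_def intro: le_refl)
    also note 1
    also have "sum u U \<le> (\<Sum>j. u j)" by (intro sum_le_suminf smu U) (auto simp: u0)
    finally show ?thesis .
  qed
  have "(\<Sum>j. u j) = (\<Sum>j. g j)"
    using suminf_le_const[OF smu upper] suminf_le_const[OF sm lower] by simp
  then show ?thesis using smu by (simp add: sums_iff)
qed

text \<open>The Crandall-Tartar argument: the projection \<open>w\<close> of \<open>max f h\<close>
  dominates \<open>u\<close> and \<open>v\<close> by monotonicity, so
  \<open>\<bar>u - v\<bar> \<le> (w - u) + (w - v)\<close>. Preservation of sums makes the total of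
  the right-hand side equal to that of \<open>(g - f) + (g - h) = \<bar>f - h\<bar>\<close>.\<close>

lemma is_proj_l1_contraction:
  assumes f: "\<And>j. 0 \<le> f j" "\<And>j. j \<notin> J \<Longrightarrow> f j = 0" "summable f" "is_proj f u"
    and h: "\<And>j. 0 \<le> h j" "\<And>j. j \<notin> J \<Longrightarrow> h j = 0" "summable h" "is_proj h v"
  shows "summable (\<lambda>j. \<bar>u j - v j\<bar>) \<and> (\<Sum>j. \<bar>u j - v j\<bar>) \<le> (\<Sum>j. \<bar>f j - h j\<bar>)"
proof -
  define g where "g = (\<lambda>j. max (f j) (h j))"
  have smg: "summable g"
    by (rule summable_comparison_test'[OF summable_add[OF f(3) h(3)], of 0])
       (use f(1) h(1) in \<open>auto simp: g_def max_def\<close>)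
  have sq: "sqsum f" "sqsum h" "sqsum g"
    using f h smg by (auto intro!: summable_imp_sqsum simp: g_def le_max_iff_disj)
  obtain w where w: "is_proj g w" using ex_is_proj sq by blast
  have uw: "u j \<le> w j" for j by (rule is_proj_mono[OF sq(1) f(4) sq(3) w]) (simp add: g_def)
  have vw: "v j \<le> w j" for j by (rule is_proj_mono[OF sq(2) h(4) sq(3) w]) (simp add: g_def)
  have "w sums suminf g"
    by (rule is_proj_sums[OF _ _ smg w]) (auto simp: g_def f h le_max_iff_disj)
  then have s: "(\<lambda>j. (w j - u j) + (w j - v j)) sums ((suminf g - suminf f) + (suminf g - suminf h))"
    using is_proj_sums[OF f] is_proj_sums[OF h] by (intro sums_add sums_diff) auto
  have "(\<lambda>j. (g j - f j) + (g j - h j)) sums ((suminf g - suminf f) + (suminf g - suminf h))"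
    by (intro sums_add sums_diff summable_sums smg f h)
  moreover have "(\<lambda>j. (g j - f j) + (g j - h j)) = (\<lambda>j. \<bar>f j - h j\<bar>)"
    by (auto simp: g_def max_def)
  ultimately have fh: "(\<lambda>j. \<bar>f j - h j\<bar>) sums ((suminf g - suminf f) + (suminf g - suminf h))"
    by simp
  have b: "\<bar>u j - v j\<bar> \<le> (w j - u j) + (w j - v j)" for j using uw[of j] vw[of j] by simp
  have sm: "summable (\<lambda>j. \<bar>u j - v j\<bar>)"
    by (rule summable_comparison_test'[OF sums_summable[OF s], of 0]) (use b in auto)
  have "(\<Sum>j. \<bar>u j - v j\<bar>) \<le> (\<Sum>j. (w j - u j) + (w j - v j))"
    by (rule suminf_le[OF b sm sums_summable[OF s]])
  then show ?thesis using sm s fh by (simp add: sums_iff)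
qed

end

subsection \<open>Norms and probability vectors\<close>

lemma lnorm_1: "lnorm 1 v = (\<Sum>j. \<bar>v j\<bar>)"
  by (simp add: lnorm_def one_enat_def)

lemma lnorm_2: "lnorm 2 v = sqrt (\<Sum>j. (v j)\<^sup>2)"
  by (simp add: lnorm_def numeral_eq_enat sqrt_def)

text \<open>Every coordinate is at most the \<open>l\<close>-norm \<open>N\<close>, so
  \<open>m - l\<close> of the \<open>m\<close> factors can be replaced by \<open>N\<close>. This
  reduces all exponents to \<open>1\<close> and \<open>2\<close>.\<close>

lemma lnorm_le_lnorm:
  assumes l: "1 \<le> l" and k: "enat l \<le> k" and sm: "summable (\<lambda>j. \<bar>v j\<bar> ^ l)"
  shows "lnorm k v \<le> lnorm (enat l) v"
proof -
  define N where "N = root l (\<Sum>j. \<bar>v j\<bar> ^ l)"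
  have s0: "0 \<le> (\<Sum>j. \<bar>v j\<bar> ^ l)" by (rule suminf_nonneg[OF sm]) simp
  have N0: "0 \<le> N" using s0 by (simp add: N_def real_root_ge_zero)
  have Nl: "N ^ l = (\<Sum>j. \<bar>v j\<bar> ^ l)" using l s0 by (simp add: N_def)
  have vN: "\<bar>v j\<bar> \<le> N" for j
  proof -
    have "\<bar>v j\<bar> ^ l \<le> N ^ l" unfolding Nl using sum_le_suminf[OF sm, of "{j}"] by simp
    then show ?thesis using N0 l by (simp add: power_mono_iff)
  qed
  show ?thesis
  proof (cases k)
    case infinity
    have "(SUP j. \<bar>v j\<bar>) \<le> N" by (rule cSUP_least) (use vN in auto)
    then show ?thesis by (simp add: infinity lnorm_def N_def)
  next
    case (enat m)
    then have m: "l \<le> m" using k by simp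
    have b: "\<bar>v j\<bar> ^ m \<le> N ^ (m - l) * \<bar>v j\<bar> ^ l" for j
    proof -
      have "\<bar>v j\<bar> ^ m = \<bar>v j\<bar> ^ (m - l) * \<bar>v j\<bar> ^ l" using m by (simp flip: power_add)
      also have "\<dots> \<le> N ^ (m - l) * \<bar>v j\<bar> ^ l"
        using vN by (intro mult_right_mono power_mono) auto
      finally show ?thesis .
    qed
    have smm: "summable (\<lambda>j. \<bar>v j\<bar> ^ m)"
      by (rule summable_comparison_test'[OF summable_mult[OF sm], of 0]) (use b in auto)
    have "(\<Sum>j. \<bar>v j\<bar> ^ m) \<le> (\<Sum>j. N ^ (m - l) * \<bar>v j\<bar> ^ l)"
      by (rule suminf_le[OF b smm summable_mult[OF sm]])
    also have "\<dots> = N ^ (m - l) * N ^ l" by (simp add: suminf_mult[OF sm] Nl)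
    also have "\<dots> = N ^ m" using m by (simp flip: power_add)
    finally have "root m (\<Sum>j. \<bar>v j\<bar> ^ m) \<le> root m (N ^ m)"
      using l m by (intro real_root_le_mono) auto
    also have "\<dots> = N" using l m N0 by (intro real_root_power_cancel) auto
    finally show ?thesis by (simp add: enat lnorm_def N_def)
  qed
qed

lemma lnorm_le_lnorm_1:
  assumes "1 \<le> k" "summable (\<lambda>j. \<bar>v j\<bar>)"
  shows "lnorm k v \<le> lnorm 1 v"
  using lnorm_le_lnorm[of 1 k v] assms by (simp add: one_enat_def)

lemma lnorm_le_lnorm_2:
  assumes "2 \<le> k" "sqsum v"
  shows "lnorm k v \<le> lnorm 2 v"
  using lnorm_le_lnorm[of 2 k v] assms by (simp add: numeral_eq_enat sqsum_def)

lemma lnorm_nonneg: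
  assumes "1 \<le> k" "summable (\<lambda>j. \<bar>v j\<bar>)"
  shows "0 \<le> lnorm k v"
proof (cases k)
  case infinity
  have "\<bar>v 0\<bar> \<le> (SUP j. \<bar>v j\<bar>)"
    using sum_le_suminf[OF assms(2), of "{_}"]
    by (intro cSUP_upper bdd_aboveI2[of _ _ "\<Sum>j. \<bar>v j\<bar>"]) auto
  then show ?thesis by (simp add: infinity lnorm_def order_trans[OF abs_ge_zero])
next
  case (enat m)
  then have m: "1 \<le> m" using assms(1) by (simp add: one_enat_def)
  have "\<bar>v j\<bar> ^ m \<le> (\<Sum>j. \<bar>v j\<bar>) ^ (m - 1) * \<bar>v j\<bar>" for j
  proof -
    have "\<bar>v j\<bar> ^ m = \<bar>v j\<bar> ^ (m - 1) * \<bar>v j\<bar>" using m power_minus_mult[of m "\<bar>v j\<bar>"] by simp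
    also have "\<dots> \<le> (\<Sum>j. \<bar>v j\<bar>) ^ (m - 1) * \<bar>v j\<bar>"
      using sum_le_suminf[OF assms(2), of "{j}"] by (intro mult_right_mono power_mono) auto
    finally show ?thesis .
  qed
  then have "summable (\<lambda>j. \<bar>v j\<bar> ^ m)"
    by (intro summable_comparison_test'[OF summable_mult[OF assms(2)], of 0]) auto
  then show ?thesis by (simp add: enat lnorm_def suminf_nonneg real_root_ge_zero)
qed

lemma pvecs_nonneg: "f \<in> pvecs J \<Longrightarrow> 0 \<le> f j"
  by (simp add: pvecs_def)

lemma pvecs_outside: "f \<in> pvecs J \<Longrightarrow> j \<notin> J \<Longrightarrow> f j = 0"
  by (simp add: pvecs_def)

lemma pvecs_summable: "f \<in> pvecs J \<Longrightarrow> summable f"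
  by (auto simp: pvecs_def sums_iff)

lemma pvecs_suminf: "f \<in> pvecs J \<Longrightarrow> suminf f = 1"
  by (auto simp: pvecs_def sums_iff)

lemma pvecs_le_1: "f \<in> pvecs J \<Longrightarrow> f j \<le> 1"
  using sum_le_suminf[OF pvecs_summable, of f J "{j}"] by (simp add: pvecs_nonneg pvecs_suminf)

lemma pvecs_diff_abs_summable:
  assumes "f \<in> pvecs J" "h \<in> pvecs J"
  shows "summable (\<lambda>j. \<bar>f j - h j\<bar>)"
proof (rule summable_comparison_test'[of "\<lambda>j. f j + h j" 0])
  show "norm \<bar>f j - h j\<bar> \<le> f j + h j" for j
    using pvecs_nonneg[OF assms(1), of j] pvecs_nonneg[OF assms(2), of j] by simp
qed (intro summable_add assms[THEN pvecs_summable])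

lemma pvecs_diff_abs_suminf_le:
  assumes "f \<in> pvecs J" "h \<in> pvecs J"
  shows "(\<Sum>j. \<bar>f j - h j\<bar>) \<le> 2"
proof -
  have "(\<Sum>j. \<bar>f j - h j\<bar>) \<le> (\<Sum>j. f j + h j)"
  proof (rule suminf_le)
    show "\<bar>f j - h j\<bar> \<le> f j + h j" for j
      using pvecs_nonneg[OF assms(1), of j] pvecs_nonneg[OF assms(2), of j] by simp
  qed (use assms pvecs_diff_abs_summable in \<open>auto intro: summable_add pvecs_summable\<close>)
  also have "\<dots> = 2"
    using suminf_add[OF pvecs_summable[OF assms(1)] pvecs_summable[OF assms(2)]] assms
    by (simp add: pvecs_suminf)
  finally show ?thesis .
qed

lemma pvecs_diff_le_suminf:
  assumes "f \<in> pvecs J" "h \<in> pvecs J"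
  shows "\<bar>f j - h j\<bar> \<le> (\<Sum>j. \<bar>f j - h j\<bar>)"
  using sum_le_suminf[OF pvecs_diff_abs_summable[OF assms], of "{j}"] by simp

lemma pvecs_sqsum: "f \<in> pvecs J \<Longrightarrow> sqsum f"
  by (rule summable_imp_sqsum) (simp add: pvecs_nonneg pvecs_summable)

lemma pvecs_diff_sqsum: "f \<in> pvecs J \<Longrightarrow> h \<in> pvecs J \<Longrightarrow> sqsum (\<lambda>j. f j - h j)"
  by (intro sqsum_diff pvecs_sqsum)

lemma pvecs_sq_dist_le:
  assumes "f \<in> pvecs J" "h \<in> pvecs J"
  shows "sq_dist h f \<le> (\<Sum>j. \<bar>f j - h j\<bar>)"
  unfolding sq_dist_def
proof (rule suminf_le)
  show "(f j - h j)\<^sup>2 \<le> \<bar>f j - h j\<bar>" for j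
  proof -
    have "\<bar>f j - h j\<bar> \<le> 1"
      using assms[THEN pvecs_nonneg, of j] assms[THEN pvecs_le_1, of j] by linarith
    then have "\<bar>f j - h j\<bar> * \<bar>f j - h j\<bar> \<le> \<bar>f j - h j\<bar> * 1" by (intro mult_left_mono) auto
    then show ?thesis by (simp add: power2_eq_square)
  qed
qed (use pvecs_diff_sqsum pvecs_diff_abs_summable assms in \<open>auto simp: sqsum_def\<close>)

text \<open>Coordinates of probability vectors are at most \<open>1\<close>. This carries a strict
  inequality between inner products at \<open>p\<close> over to nearby empirical
  distributions.\<close>

lemma l2_inner_pvecs_diff:
  assumes f: "f \<in> pvecs J" and h: "h \<in> pvecs J" and u: "u \<in> pvecs J" and v: "v \<in> pvecs J"
  shows "\<bar>l2_inner f u - l2_inner h v\<bar> \<le> (\<Sum>j. \<bar>f j - h j\<bar>) + (\<Sum>j. \<bar>u j - v j\<bar>)"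
proof -
  note sq = f[THEN pvecs_sqsum] h[THEN pvecs_sqsum] u[THEN pvecs_sqsum] v[THEN pvecs_sqsum]
  have sm: "summable (\<lambda>j. \<bar>f j - h j\<bar> + \<bar>u j - v j\<bar>)"
    by (intro summable_add pvecs_diff_abs_summable[of _ J] f h u v)
  have b: "\<bar>f j * u j - h j * v j\<bar> \<le> \<bar>f j - h j\<bar> + \<bar>u j - v j\<bar>" for j
  proof -
    have "f j * u j - h j * v j = (f j - h j) * u j + h j * (u j - v j)" by (simp add: algebra_simps)
    also have "\<bar>\<dots>\<bar> \<le> \<bar>f j - h j\<bar> * u j + h j * \<bar>u j - v j\<bar>"
      using pvecs_nonneg[OF u, of j] pvecs_nonneg[OF h, of j]
      by (intro order_trans[OF abs_triangle_ineq]) (simp add: abs_mult)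
    also have "\<dots> \<le> \<bar>f j - h j\<bar> * 1 + 1 * \<bar>u j - v j\<bar>"
      using pvecs_le_1[OF u, of j] pvecs_le_1[OF h, of j]
      by (intro add_mono mult_left_mono mult_right_mono) auto
    finally show ?thesis by simp
  qed
  have sma: "summable (\<lambda>j. \<bar>f j * u j - h j * v j\<bar>)"
    by (rule summable_comparison_test'[OF sm, of 0]) (use b in auto)
  have "l2_inner f u - l2_inner h v = (\<Sum>j. f j * u j - h j * v j)"
    unfolding l2_inner_def by (intro suminf_diff summable_mult_sqsum sq)
  also have "\<bar>\<dots>\<bar> \<le> (\<Sum>j. \<bar>f j * u j - h j * v j\<bar>)" by (rule summable_rabs[OF sma])
  also have "\<dots> \<le> (\<Sum>j. \<bar>f j - h j\<bar> + \<bar>u j - v j\<bar>)" by (rule suminf_le[OF b sma sm])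
  also have "\<dots> = (\<Sum>j. \<bar>f j - h j\<bar>) + (\<Sum>j. \<bar>u j - v j\<bar>)"
    by (intro suminf_add[symmetric] pvecs_diff_abs_summable[of _ J] f h u v)
  finally show ?thesis .
qed

subsection \<open>Frequency data\<close>

lemma freq_data_le: "x \<in> freq_data J n \<Longrightarrow> x j \<le> n"
  unfolding freq_data_def
  using member_le_sum[of j "{j. x j > 0}" x] by (cases "x j > 0") auto

lemma freq_data_sum:
  assumes "x \<in> freq_data J n" "finite A" "{j. x j > 0} \<subseteq> A"
  shows "(\<Sum>j\<in>A. real (x j)) = real n"
proof -
  have "(\<Sum>j\<in>A. real (x j)) = (\<Sum>j | x j > 0. real (x j))"
    using assms by (intro sum.mono_neutral_right) auto
  also have "\<dots> = real n" using assms(1) by (simp add: freq_data_def flip: of_nat_sum)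
  finally show ?thesis .
qed

lemma freq_data_le_last_index:
  assumes "x \<in> freq_data J n" "x j > 0"
  shows "j \<le> last_index x"
proof -
  have "finite {j. x j > 0}" using assms by (simp add: freq_data_def)
  then show ?thesis
    using assms(2) unfolding last_index_def by (intro le_cSup_finite) auto
qed

lemma freq_data_sum_last_index:
  "x \<in> freq_data J n \<Longrightarrow> (\<Sum>j\<le>last_index x. real (x j)) = real n"
  by (rule freq_data_sum) (auto intro: freq_data_le_last_index)

lemma emp_in_pvecs:
  assumes x: "x \<in> freq_data J n" and n: "1 \<le> n"
  shows "emp n x \<in> pvecs J"
proof -
  have "emp n x sums (\<Sum>j | x j > 0. emp n x j)"
    using x by (intro sums_finite) (auto simp: freq_data_def emp_def)
  moreover have "(\<Sum>j | x j > 0. emp n x j) = 1"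
    unfolding emp_def using freq_data_sum[OF x, of "{j. x j > 0}"] x n
    by (simp add: freq_data_def flip: sum_divide_distrib)
  ultimately have "emp n x sums 1" by simp
  then show ?thesis using x by (auto simp: pvecs_def emp_def freq_data_def)
qed

lemma loo_emp_in_pvecs:
  assumes x: "x \<in> freq_data J n" and n: "2 \<le> n" and i: "x i > 0"
  shows "loo_emp n x i \<in> pvecs J"
proof -
  let ?A = "{j. x j > 0}"
  have A: "finite ?A" using x by (simp add: freq_data_def)
  have "loo_emp n x i sums (\<Sum>j\<in>?A. loo_emp n x i j)"
    by (rule sums_finite[OF A]) (use i in \<open>auto simp: loo_emp_def\<close>)
  moreover have "(\<Sum>j\<in>?A. loo_emp n x i j) = (\<Sum>j\<in>?A. real (x j) - (if j = i then 1 else 0)) / (real n - 1)"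
    by (simp add: loo_emp_def flip: sum_divide_distrib)
  moreover have "(\<Sum>j\<in>?A. real (x j) - (if j = i then 1 else 0)) = real n - 1"
    using freq_data_sum[OF x A] A i by (simp add: sum_subtractf sum.delta)
  ultimately have "loo_emp n x i sums 1" using n by simp
  moreover have "0 \<le> loo_emp n x i j" for j using n i by (auto simp: loo_emp_def)
  moreover have "loo_emp n x i j = 0" if "j \<notin> J" for j
    using that x i by (auto simp: loo_emp_def freq_data_def)
  ultimately show ?thesis by (simp add: pvecs_def)
qed

text \<open>Deleting an observation of cell \<open>i\<close> changes the vector by
  \<open>emp\<close> minus the unit vector at \<open>i\<close>, divided by \<open>n - 1\<close>. The
  sup-norm contraction passes the bound on to the fits.\<close>

lemma loo_emp_diff_emp:
  assumes x: "x \<in> freq_data J n" and n: "2 \<le> n"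
  shows "\<bar>loo_emp n x i k - emp n x k\<bar> \<le> 1 / (real n - 1)"
proof -
  have eq: "loo_emp n x i k - emp n x k = (emp n x k - (if k = i then 1 else 0)) / (real n - 1)"
    using n by (simp add: loo_emp_def emp_def field_simps)
  have "0 \<le> emp n x k" "emp n x k \<le> 1" using freq_data_le[OF x, of k] n by (auto simp: emp_def)
  then have "\<bar>emp n x k - (if k = i then 1 else 0)\<bar> \<le> 1" by auto
  then show ?thesis unfolding eq abs_divide using n by (simp add: divide_right_mono)
qed

lemma loo_emp_diff:
  assumes "2 \<le> n"
  shows "\<bar>loo_emp n x i k - loo_emp n x j k\<bar> \<le> 1 / (real n - 1)"
  using assms unfolding loo_emp_def by (auto simp flip: diff_divide_distrib)

text \<open>The factor changes the denominator from \<open>n - 1\<close> to \<open>n\<close>, after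
  which only the deleted observation is missing. It is the origin of the sequence \<open>c n\<close>
  in \<open>loo_dominated\<close>.\<close>

lemma loo_emp_scaled_le_emp:
  assumes "2 \<le> n"
  shows "(1 - 1 / real n) * loo_emp n x i k \<le> emp n x k"
proof -
  have "(1 - 1 / real n) * loo_emp n x i k = (real (x k) - (if k = i then 1 else 0)) / real n"
    using assms by (simp add: loo_emp_def field_simps)
  then show ?thesis by (simp add: emp_def divide_right_mono)
qed

subsection \<open>Isotonic regression of probability vectors\<close>

context finite_upset_preorder
begin

lemma is_proj_pvecs:
  assumes "g \<in> pvecs J" "is_proj g u"
  shows "u \<in> pvecs J"
proof -
  have "u sums suminf g"
    by (rule is_proj_sums[OF _ _ _ assms(2)])
       (use assms(1) in \<open>auto simp: pvecs_nonneg pvecs_outside pvecs_summable\<close>)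
  then show ?thesis
    using assms by (auto simp: pvecs_def is_proj_def cone_def sums_iff)
qed

text \<open>The cone contains all isotonic probability vectors, and the projection of a probability
  vector is again one, so both minimisation problems have the same solution. The squared distance
  grows by at least the squared norm of \<open>w - u\<close>, which gives uniqueness.\<close>

lemma is_arg_min_iff_is_proj:
  assumes g: "g \<in> pvecs J" and u: "is_proj g u"
    and P: "\<And>f. P f \<longleftrightarrow> f \<in> pvecs J \<and> (\<forall>i\<in>J. \<forall>j\<in>J. le i j \<longrightarrow> f i \<le> f j)"
  shows "is_arg_min (sq_dist g) P f \<longleftrightarrow> f = u"
proof -
  have uc: "u \<in> cone" using u by (simp add: is_proj_def)
  have Pc: "w \<in> cone" if "P w" for w
    using that pvecs_sqsum by (auto simp: P cone_def pvecs_def)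
  have Pu: "P u" using is_proj_pvecs[OF g u] uc by (auto simp: P cone_def)
  have le: "sq_dist g u + l2_inner (\<lambda>j. w j - u j) (\<lambda>j. w j - u j) \<le> sq_dist g w" if "P w" for w
    using sq_dist_expand[of g u w] is_projD[OF u Pc[OF that]] pvecs_sqsum[OF g]
      cone_sqsum[OF uc] cone_sqsum[OF Pc[OF that]] by simp
  have sq: "sqsum (\<lambda>j. w j - u j)" if "P w" for w
    by (intro sqsum_diff cone_sqsum Pc uc that)
  show ?thesis
  proof
    assume "is_arg_min (sq_dist g) P f"
    then have f: "P f" "sq_dist g f \<le> sq_dist g u"
      using Pu by (auto simp: is_arg_min_def not_less)
    then have "l2_inner (\<lambda>j. f j - u j) (\<lambda>j. f j - u j) \<le> 0" using le[OF f(1)] by linarith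
    then have "f j - u j = 0" for j by (rule l2_inner_self_eq_0[OF sq[OF f(1)]])
    then show "f = u" by (intro ext) simp
  next
    assume "f = u"
    moreover have "sq_dist g u \<le> sq_dist g w" if "P w" for w
      using le[OF that] l2_inner_self_nonneg[OF sq[OF that]] by linarith
    ultimately show "is_arg_min (sq_dist g) P f" using Pu by (auto simp: is_arg_min_def not_less)
  qed
qed

end

locale isotonic_regression = finite_upset_preorder +
  fixes T :: "(nat \<Rightarrow> real) \<Rightarrow> nat \<Rightarrow> real"
  assumes is_proj_T: "g \<in> pvecs J \<Longrightarrow> is_proj g (T g)"
begin

lemma T_pvecs: "g \<in> pvecs J \<Longrightarrow> T g \<in> pvecs J"
  using is_proj_T is_proj_pvecs by blast

text \<open>One use of \<open>is_proj_mono_shift\<close> in each direction. The pointwise bound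
  \<open>c\<close> fits the leave-one-out estimates directly, without a supremum.\<close>

lemma T_sup_contraction:
  assumes "f \<in> pvecs J" "h \<in> pvecs J" "\<And>j. \<bar>f j - h j\<bar> \<le> c"
  shows "\<bar>T f j - T h j\<bar> \<le> c"
proof -
  have c: "0 \<le> c" using assms(3)[of 0] by linarith
  have *: "T f j \<le> T h j + c" if "f \<in> pvecs J" "h \<in> pvecs J" "\<And>j. \<bar>f j - h j\<bar> \<le> c" for f h
  proof (rule is_proj_mono_shift[OF pvecs_sqsum is_proj_T pvecs_sqsum is_proj_T c])
    show "f j \<le> h j + c" for j using that(3)[of j] by linarith
  qed (use that in auto)
  show ?thesis using *[OF assms] *[OF assms(2,1)] assms(3) by (simp add: abs_minus_commute abs_le_iff)
qed

lemma T_l1_contraction: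
  assumes "f \<in> pvecs J" "h \<in> pvecs J"
  shows "(\<Sum>j. \<bar>T f j - T h j\<bar>) \<le> (\<Sum>j. \<bar>f j - h j\<bar>)"
  using assms pvecs_nonneg pvecs_outside pvecs_summable is_proj_T
  by (intro is_proj_l1_contraction[THEN conjunct2]) blast+

lemma T_sq_dist_contraction:
  assumes "f \<in> pvecs J" "h \<in> pvecs J"
  shows "sq_dist (T h) (T f) \<le> sq_dist h f"
  using assms by (intro is_proj_l2_contraction is_proj_T pvecs_sqsum)

lemma l2_continuous_T: "l2_continuous J T"
  unfolding l2_continuous_def
proof (intro ballI allI impI)
  fix f and \<epsilon> :: real assume f: "f \<in> pvecs J" and e: "0 < \<epsilon>"
  have "lnorm 2 (\<lambda>j. T h j - T f j) \<le> lnorm 2 (\<lambda>j. h j - f j)" if h: "h \<in> pvecs J" for h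
    using T_sq_dist_contraction[OF h f] by (simp add: lnorm_2 sq_dist_def)
  then show "\<exists>\<delta>>0. \<forall>h\<in>pvecs J. lnorm 2 (\<lambda>j. h j - f j) < \<delta> \<longrightarrow> lnorm 2 (\<lambda>j. T h j - T f j) < \<epsilon>"
    using e by (intro exI[of _ \<epsilon>]) (auto intro: le_less_trans)
qed

lemma linf_contraction_T: "linf_contraction J T"
  unfolding linf_contraction_def
proof (intro ballI)
  fix f h assume fh: "f \<in> pvecs J" "h \<in> pvecs J"
  have "\<bar>f j - h j\<bar> \<le> (SUP j. \<bar>f j - h j\<bar>)" for j
    using pvecs_diff_le_suminf[OF fh] by (intro cSUP_upper bdd_aboveI2) auto
  then have "(SUP j. \<bar>T f j - T h j\<bar>) \<le> (SUP j. \<bar>f j - h j\<bar>)"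
    using T_sup_contraction[OF fh] by (intro cSUP_least) auto
  then show "lnorm \<infinity> (\<lambda>j. T f j - T h j) \<le> lnorm \<infinity> (\<lambda>j. f j - h j)"
    by (simp add: lnorm_def)
qed

lemma residual_eq_sq_dist:
  "f \<in> pvecs J \<Longrightarrow> l2_inner f (\<lambda>j. f j - T f j) = sq_dist f (T f)"
  by (intro is_proj_residual pvecs_sqsum is_proj_T)

lemma orthogonal_residual_T: "orthogonal_residual J T"
  unfolding orthogonal_residual_def
proof (intro ballI conjI)
  fix f assume f: "f \<in> pvecs J"
  show "l2_inner (T f) (\<lambda>j. f j - T f j) = 0"
    by (intro is_proj_orthogonal pvecs_sqsum[OF f] is_proj_T[OF f])
  show "0 \<le> l2_inner f (\<lambda>j. f j - T f j)"
    unfolding residual_eq_sq_dist[OF f] sq_dist_eq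
    by (intro l2_inner_self_nonneg pvecs_diff_sqsum[of _ J] f T_pvecs)
qed

lemma loo_fit_nonneg:
  assumes "x \<in> freq_data J n" "2 \<le> n"
  shows "0 \<le> loo_fit T n x i k"
  using pvecs_nonneg[OF T_pvecs[OF loo_emp_in_pvecs[OF assms]]] by (simp add: loo_fit_def)

text \<open>By homogeneity the scaled fit is the projection of the scaled leave-one-out vector,
  which lies below \<open>emp n x\<close>; monotonicity does the rest.\<close>

lemma loo_fit_scaled_le:
  assumes x: "x \<in> freq_data J n" and n: "2 \<le> n"
  shows "(1 - 1 / real n) * loo_fit T n x j j \<le> T (emp n x) j"
proof (cases "x j > 0")
  case True
  note f = loo_emp_in_pvecs[OF x n True]
  note h = emp_in_pvecs[OF x, OF order_trans[OF one_le_numeral n]]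
  have c: "0 < 1 - 1 / real n" using n by simp
  have "(1 - 1 / real n) * T (loo_emp n x j) j \<le> T (emp n x) j"
    by (rule is_proj_mono[OF sqsum_cmult[OF pvecs_sqsum[OF f]] is_proj_cmult[OF pvecs_sqsum[OF f] is_proj_T[OF f] c]
          pvecs_sqsum[OF h] is_proj_T[OF h] loo_emp_scaled_le_emp[OF n]])
  then show ?thesis using True by (simp add: loo_fit_def)
next
  case False
  then show ?thesis
    using pvecs_nonneg[OF T_pvecs[OF emp_in_pvecs[OF x]]] n by (simp add: loo_fit_def)
qed

lemma loo_dominated_T: "loo_dominated J T"
  unfolding loo_dominated_def
proof (intro exI[of _ "\<lambda>n. 1 - 1 / real n"] conjI allI impI ballI loo_fit_scaled_le)
  show "(\<lambda>n. 1 - 1 / real n) \<longlonglongrightarrow> 1"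
    using tendsto_diff[OF tendsto_const[of 1] lim_1_over_n] by simp
qed

end

subsection \<open>The mixture parameter\<close>

lemma beta_L_nonneg: "0 \<le> beta_L d T n x"
  by (auto simp: beta_L_def beta_L1_def beta_L2_def Let_def)

lemma beta_L_le_1: "beta_L d T n x \<le> 1"
  by (auto simp: beta_L_def beta_L1_def beta_L2_def Let_def divide_le_eq)

lemma l2_inner_emp:
  assumes x: "x \<in> freq_data J n"
  shows "l2_inner (emp n x) v = (\<Sum>j\<le>last_index x. emp n x j * v j)"
  unfolding l2_inner_def
  by (rule suminf_finite) (use freq_data_le_last_index[OF x] in \<open>force simp: emp_def\<close>)+

context isotonic_regression
begin

text \<open>The summands of the \<open>L\<^sub>1\<close> criterion simplify to \<open>x (x - n g) + g x\<close>.\<close>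

lemma beta_L1_eq_0:
  assumes x: "x \<in> freq_data J n" and n: "2 \<le> n"
    and le: "1 / real n \<le> l2_inner (emp n x) (emp n x)
               - real n / (real n - 1) * l2_inner (emp n x) (T (emp n x))"
  shows "beta_L1 T n x = 0"
proof -
  define g where "g = loo_fit T n x"
  define f where "f = emp n x"
  \<comment> \<open>The reciprocal of \<open>1 - 1 / n\<close>: it turns the leave-one-out
    domination into \<open>g j j \<le> c * T f j\<close>.\<close>
  define c where "c = real n / (real n - 1)"
  have n0: "0 < real n" "0 < real n - 1" using n by auto
  have b: "(real n)\<^sup>2 * (f j * f j - c * (f j * T f j)) \<le>
     (real (x j) - real n * g j j)\<^sup>2 + (real n + 1) * g j j * (real (x j) - real n * g j j)
            + real n * (g j j)\<^sup>2" (is "_ \<le> ?r") for j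
  proof -
    have g0: "0 \<le> g j j" unfolding g_def by (rule loo_fit_nonneg[OF x n])
    have "(1 - 1 / real n) * g j j \<le> T f j"
      unfolding g_def f_def by (rule loo_fit_scaled_le[OF x n])
    then have "c * ((1 - 1 / real n) * g j j) \<le> c * T f j"
      using n0 by (intro mult_left_mono) (auto simp: c_def)
    moreover have "c * ((1 - 1 / real n) * g j j) = g j j" using n0 by (simp add: c_def field_simps)
    ultimately have gT: "g j j \<le> c * T f j" by simp
    have xf: "real (x j) = real n * f j" using n0 by (simp add: f_def emp_def)
    have f0: "0 \<le> f j" by (simp add: f_def emp_def)
    have "f j * g j j \<le> f j * (c * T f j)" using gT f0 by (rule mult_left_mono)
    then have "(real n)\<^sup>2 * (f j * f j - c * (f j * T f j)) \<le> (real n)\<^sup>2 * (f j * f j - f j * g j j)"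
      by (intro mult_left_mono) (auto simp: mult_ac)
    \<comment> \<open>The added term is the nonnegative remainder \<open>g j j * x j\<close>; with
      it the summand of the criterion is matched exactly.\<close>
    also have "\<dots> \<le> (real n)\<^sup>2 * (f j * f j - f j * g j j) + g j j * (real n * f j)"
      using g0 f0 by simp
    also have "\<dots> = ?r" unfolding xf by (simp add: power2_eq_square algebra_simps)
    finally show ?thesis .
  qed
  have "real n = (real n)\<^sup>2 * (1 / real n)" using n0 by (simp add: power2_eq_square)
  also have "\<dots> \<le> (real n)\<^sup>2 * (l2_inner f f - c * l2_inner f (T f))"
    using le unfolding f_def c_def by (intro mult_left_mono) auto
  also have "\<dots> = (\<Sum>j\<le>last_index x. (real n)\<^sup>2 * (f j * f j - c * (f j * T f j)))"
    unfolding f_def l2_inner_emp[OF x] by (simp add: sum_distrib_left sum_subtractf right_diff_distrib)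
  also have "\<dots> \<le> (\<Sum>j\<le>last_index x. (real (x j) - real n * g j j)\<^sup>2
            + (real n + 1) * g j j * (real (x j) - real n * g j j) + real n * (g j j)\<^sup>2)"
    by (rule sum_mono) (rule b)
  finally show ?thesis by (simp add: beta_L1_def Let_def g_def)
qed

text \<open>Two leave-one-out vectors differ by at most \<open>1 / (n - 1)\<close> per coordinate,
  hence so do the fits. The factor \<open>n - 1\<close> cancels this, so the double sum contributes
  at most \<open>n^2\<close>, as does the leading term; the subtracted squares only help.\<close>

lemma coeff_b_le:
  assumes x: "x \<in> freq_data J n" and n: "2 \<le> n"
  shows "coeff_b T n x \<le> 2 * (real n)\<^sup>2"
proof -
  define g where "g = loo_fit T n x"
  define t where "t = last_index x"
  have n0: "0 < real n - 1" using n by auto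
  have s: "(\<Sum>j\<le>t. real (x j)) = real n"
    unfolding t_def by (rule freq_data_sum_last_index[OF x])
  have gg: "real (x j) * (real (x k) * (g k k - g j k)) \<le> real (x j) * (real (x k) * (1 / (real n - 1)))" for j k
  proof (cases "x j > 0 \<and> x k > 0")
    case True
    then have "\<bar>T (loo_emp n x k) k - T (loo_emp n x j) k\<bar> \<le> 1 / (real n - 1)"
      by (intro T_sup_contraction loo_emp_in_pvecs[OF x n] loo_emp_diff[OF n]) auto
    then have "g k k - g j k \<le> 1 / (real n - 1)"
      unfolding g_def loo_fit_def using True by auto
    then show ?thesis by (intro mult_left_mono) auto
  qed auto
  have "(\<Sum>j\<le>t. real (x j) * (\<Sum>k\<le>t. real (x k) * (g k k - g j k)))
      \<le> (\<Sum>j\<le>t. real (x j) * (\<Sum>k\<le>t. real (x k) * (1 / (real n - 1))))"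
    unfolding sum_distrib_left by (intro sum_mono gg)
  also have "\<dots> = real n * (real n * (1 / (real n - 1)))"
    unfolding sum_distrib_right[symmetric] s ..
  finally have "(real n - 1) * (\<Sum>j\<le>t. real (x j) * (\<Sum>k\<le>t. real (x k) * (g k k - g j k)))
      \<le> (real n - 1) * (real n * (real n * (1 / (real n - 1))))"
    using n0 by (intro mult_left_mono) auto
  also have "\<dots> = (real n)\<^sup>2" using n0 by (simp add: power2_eq_square)
  finally show ?thesis
    using sum_nonneg[of "{..t}" "\<lambda>j. (real (x j))\<^sup>2"]
    unfolding coeff_b_def Let_def g_def[symmetric] t_def[symmetric] by simp
qed

text \<open>A single cell whose observed frequency exceeds the fit by \<open>e\<close> makes \<open>a\<^sub>n\<close> of order \<open>n\<^sup>3\<close>.\<close>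

lemma coeff_a_ge:
  assumes x: "x \<in> freq_data J n" and n: "2 \<le> n" and e: "0 < e"
    and le: "e \<le> emp n x k - T (emp n x) k - 1 / real n"
  shows "real n ^ 3 * e\<^sup>2 - 2 * (real n)\<^sup>2 \<le> coeff_a T n x"
proof -
  define g where "g = loo_fit T n x"
  define t where "t = last_index x"
  define h where "h = (\<lambda>j. \<Sum>k\<le>t. (real (x k) - (real n - 1) * g j k)\<^sup>2)"
  have n0: "0 < real n" "0 < real n - 1" using n by auto
  have s: "(\<Sum>j\<le>t. real (x j)) = real n"
    unfolding t_def by (rule freq_data_sum_last_index[OF x])
  have f: "emp n x \<in> pvecs J" by (rule emp_in_pvecs[OF x]) (use n in simp)
  have "0 < emp n x k"
    using e le pvecs_nonneg[OF T_pvecs[OF f], of k] divide_nonneg_pos[of 1 "real n"] n0 by linarith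
  then have kt: "k \<le> t"
    unfolding t_def by (intro freq_data_le_last_index[OF x]) (auto simp: emp_def zero_less_divide_iff)
  have xh: "real (x j) * (real n * e)\<^sup>2 \<le> real (x j) * h j" for j
  proof (cases "x j > 0")
    case True
    have Tk: "0 \<le> T (emp n x) k" by (rule pvecs_nonneg[OF T_pvecs[OF f]])
    have "\<bar>T (loo_emp n x j) k - T (emp n x) k\<bar> \<le> 1 / (real n - 1)"
      by (intro T_sup_contraction loo_emp_in_pvecs[OF x n] loo_emp_diff_emp[OF x n] f True)
    then have "g j k \<le> T (emp n x) k + 1 / (real n - 1)"
      using True by (simp add: g_def loo_fit_def)
    then have "(real n - 1) * g j k \<le> (real n - 1) * (T (emp n x) k + 1 / (real n - 1))"
      using n0 by (intro mult_left_mono) auto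
    also have "\<dots> = (real n - 1) * T (emp n x) k + 1" using n0 by (simp add: distrib_left)
    also have "\<dots> \<le> real n * T (emp n x) k + 1" using Tk by (simp add: mult_right_mono)
    finally have 1: "(real n - 1) * g j k \<le> real n * T (emp n x) k + 1" .
    \<comment> \<open>The \<open>1 / n\<close> set aside in the hypothesis pays for the
      \<open>+ 1\<close> that arises from replacing the leave-one-out fit by
      \<open>T (emp n x)\<close>.\<close>
    have "real n * e \<le> real n * (emp n x k - T (emp n x) k - 1 / real n)"
      using le n0 by (intro mult_left_mono) auto
    also have "\<dots> = real (x k) - (real n * T (emp n x) k + 1)"
      using n0 by (simp add: emp_def right_diff_distrib)
    finally have "real n * e \<le> real (x k) - (real n - 1) * g j k" using 1 by linarith
    then have "(real n * e)\<^sup>2 \<le> (real (x k) - (real n - 1) * g j k)\<^sup>2"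
      using n0 e by (intro power_mono) auto
    also have "\<dots> \<le> h j" unfolding h_def using kt by (intro member_le_sum) auto
    finally show ?thesis by (intro mult_left_mono) auto
  qed simp
  have "(\<Sum>j\<le>t. real (x j) * (2 * (real (x j) - g j j * (real n - 1)) - h j))
      \<le> (\<Sum>j\<le>t. real (x j) * (2 * real n - (real n * e)\<^sup>2))"
  proof (rule sum_mono)
    fix j
    have "0 \<le> g j j * (real n - 1)"
      using n0 loo_fit_nonneg[OF x n, of j j] by (simp add: g_def)
    moreover have "real (x j) \<le> real n" using freq_data_le[OF x, of j] by simp
    ultimately have "real (x j) * (2 * (real (x j) - g j j * (real n - 1))) \<le> real (x j) * (2 * real n)"
      by (intro mult_left_mono) auto
    then show "real (x j) * (2 * (real (x j) - g j j * (real n - 1)) - h j)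
        \<le> real (x j) * (2 * real n - (real n * e)\<^sup>2)"
      using xh[of j] by (simp add: right_diff_distrib)
  qed
  also have "\<dots> = real n * (2 * real n - (real n * e)\<^sup>2)"
    unfolding sum_distrib_right[symmetric] s ..
  also have "\<dots> = 2 * (real n)\<^sup>2 - real n ^ 3 * e\<^sup>2"
    by (simp add: power2_eq_square power3_eq_cube algebra_simps)
  finally show ?thesis
    unfolding coeff_a_def Let_def g_def[symmetric] t_def[symmetric] h_def by simp
qed

text \<open>The condition \<open>4 \<le> n * e^2\<close> lets half of the cubic term absorb
  \<open>2 * n^2\<close>, so \<open>a \<ge> n^3 * e^2 / 2\<close>. Dividing
  \<open>b \<le> 2 * n^2\<close> by this yields the constant \<open>4 / e^2\<close>.\<close>

lemma beta_L2_le: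
  assumes x: "x \<in> freq_data J n" and n: "2 \<le> n" and e: "0 < e"
    and le: "e \<le> emp n x k - T (emp n x) k - 1 / real n" and ne: "4 \<le> real n * e\<^sup>2"
  shows "beta_L2 T n x \<le> (4 / e\<^sup>2) / real n"
proof -
  define a where "a = coeff_a T n x"
  define b where "b = coeff_b T n x"
  have n0: "0 < real n" using n by auto
  have a: "real n ^ 3 * e\<^sup>2 / 2 \<le> a"
  proof -
    have "(real n)\<^sup>2 * 4 \<le> (real n)\<^sup>2 * (real n * e\<^sup>2)" using ne by (intro mult_left_mono) auto
    then show ?thesis
      using coeff_a_ge[OF x n e le] by (simp add: a_def power2_eq_square power3_eq_cube mult_ac)
  qed
  have pos: "0 < real n ^ 3 * e\<^sup>2 / 2" using n0 e by simp
  then have a0: "0 < a" using a by linarith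
  have "beta_L2 T n x \<le> 2 * (real n)\<^sup>2 / (real n ^ 3 * e\<^sup>2 / 2)"
  proof (cases "0 \<le> b \<and> b \<le> a")
    case True
    then have "beta_L2 T n x = b / a" using a0 by (simp add: beta_L2_def a_def b_def Let_def)
    also have "\<dots> \<le> 2 * (real n)\<^sup>2 / (real n ^ 3 * e\<^sup>2 / 2)"
      using True a pos coeff_b_le[OF x n] by (intro frac_le) (auto simp: b_def)
    finally show ?thesis .
  next
    case False
    show ?thesis
    proof (cases "b < 0")
      case True
      then show ?thesis using pos a0 by (simp add: beta_L2_def a_def b_def Let_def)
    next
      case b: False
      \<comment> \<open>The parameter is \<open>1\<close> here, but \<open>a < b\<close> forces the
        claimed bound to be at least \<open>1\<close>.\<close>
      then have "a < b" using False by simp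
      then have "real n ^ 3 * e\<^sup>2 / 2 \<le> 2 * (real n)\<^sup>2"
        using a coeff_b_le[OF x n] by (simp add: b_def)
      then have "1 \<le> 2 * (real n)\<^sup>2 / (real n ^ 3 * e\<^sup>2 / 2)"
        using pos by (subst le_divide_eq_1_pos) auto
      then show ?thesis using beta_L_le_1[of 2 T n x] by (simp add: beta_L_def)
    qed
  qed
  also have "\<dots> = (4 / e\<^sup>2) / real n"
    using n0 e by (simp add: field_simps power2_eq_square power3_eq_cube)
  finally show ?thesis .
qed

text \<open>Both gaps used by the criteria, the inner product gap \<open>D\<close> and the
  coordinate gap \<open>\<delta>\<close>, are open conditions at \<open>p\<close>; closeness in
  \<open>\<ell>\<^sub>1\<close> preserves a part of each, since \<open>T\<close> is an
  \<open>\<ell>\<^sub>1\<close> contraction.\<close>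

lemma beta_L_le:
  assumes p: "p \<in> pvecs J" and ne: "T p \<noteq> p"
  shows "\<exists>C\<ge>0. \<exists>e>0. \<forall>d\<in>{1, 2}. \<forall>\<^sub>F n in sequentially. \<forall>x\<in>freq_data J n.
           (\<Sum>j. \<bar>emp n x j - p j\<bar>) \<le> e \<longrightarrow> beta_L d T n x \<le> C / real n"
proof -
  define D where "D = l2_inner p p - l2_inner p (T p)"
  have Tp: "T p \<in> pvecs J" by (rule T_pvecs[OF p])
  note sq = pvecs_sqsum[OF p] pvecs_sqsum[OF Tp]
  have D: "D = l2_inner p (\<lambda>j. p j - T p j)" unfolding D_def by (simp add: l2_inner_diff_right sq)
  have "0 < D"
  proof (rule ccontr)
    assume "\<not> 0 < D"
    then have "l2_inner (\<lambda>j. T p j - p j) (\<lambda>j. T p j - p j) \<le> 0"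
      using D residual_eq_sq_dist[OF p] by (simp add: sq_dist_eq)
    then have "T p j - p j = 0" for j by (rule l2_inner_self_eq_0[OF sqsum_diff[OF sq(2,1)]])
    then show False using ne by (auto simp: fun_eq_iff)
  qed
  \<comment> \<open>\<open>D > 0\<close> excludes \<open>p \<le> T p\<close> everywhere. The cell
    \<open>k\<close> is the one on which \<open>coeff_a_ge\<close> relies.\<close>
  have "\<exists>k. T p k < p k"
  proof (rule ccontr)
    assume "\<not> ?thesis"
    then have "p j * p j \<le> p j * T p j" for j
      using pvecs_nonneg[OF p, of j] by (intro mult_left_mono) (auto simp: not_less)
    then have "l2_inner p p \<le> l2_inner p (T p)"
      unfolding l2_inner_def by (intro suminf_le summable_mult_sqsum sq) auto
    then show False using \<open>0 < D\<close> by (simp add: D_def)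
  qed
  then obtain k where k: "T p k < p k" by blast
  define \<delta> where "\<delta> = p k - T p k"
  have \<delta>: "0 < \<delta>" using k by (simp add: \<delta>_def)
  \<comment> \<open>With \<open>D / 8\<close>, the two inner products move by \<open>2 * e\<close>
    each, and the remaining \<open>D / 2\<close> beats \<open>1 / n + 1 / (n - 1)\<close>. With
    \<open>\<delta> / 8\<close>, the two coordinates move by \<open>e\<close> each and
    \<open>1 / n\<close> takes another \<open>\<delta> / 4\<close>, which leaves the gap
    \<open>\<delta> / 2\<close> for \<open>beta_L2_le\<close>; \<open>C\<close> below is its
    constant for that gap.\<close>
  define e where "e = min (D / 8) (\<delta> / 8)"
  have e: "0 < e" "e \<le> D / 8" "e \<le> \<delta> / 8" using \<open>0 < D\<close> \<delta> by (auto simp: e_def)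
  define C where "C = 4 / (\<delta> / 2)\<^sup>2"
  have C: "0 \<le> C" by (simp add: C_def)
  have l1: "\<forall>\<^sub>F n in sequentially. 1 / real n + 1 / (real n - 1) \<le> D / 2"
    and l2: "\<forall>\<^sub>F n in sequentially. 1 / real n \<le> \<delta> / 4"
    and l3: "\<forall>\<^sub>F n in sequentially. 4 \<le> real n * (\<delta> / 2)\<^sup>2"
    using \<open>0 < D\<close> \<delta> by real_asymp+
  have main: "\<forall>\<^sub>F n in sequentially. \<forall>x\<in>freq_data J n.
      (\<Sum>j. \<bar>emp n x j - p j\<bar>) \<le> e \<longrightarrow> beta_L1 T n x \<le> C / real n \<and> beta_L2 T n x \<le> C / real n"
    using l1 l2 l3 eventually_ge_at_top[of 2]
  proof eventually_elim
    case (elim n)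
    note n = elim(4)
    have n0: "0 < real n" "0 < real n - 1" using n by auto
    show ?case
    proof (intro ballI impI conjI)
      fix x assume x: "x \<in> freq_data J n" and xe: "(\<Sum>j. \<bar>emp n x j - p j\<bar>) \<le> e"
      define f where "f = emp n x"
      have f: "f \<in> pvecs J" unfolding f_def by (rule emp_in_pvecs[OF x]) (use n in simp)
      have Tf: "T f \<in> pvecs J" by (rule T_pvecs[OF f])
      have fe: "(\<Sum>j. \<bar>f j - p j\<bar>) \<le> e" using xe by (simp add: f_def)
      have Te: "(\<Sum>j. \<bar>T f j - T p j\<bar>) \<le> e" using T_l1_contraction[OF f p] fe by simp
      have i1: "l2_inner p p - 2 * e \<le> l2_inner f f"
        using l2_inner_pvecs_diff[OF f p f p] fe by linarith
      have i2: "l2_inner f (T f) \<le> l2_inner p (T p) + 2 * e"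
        using l2_inner_pvecs_diff[OF f p Tf Tp] fe Te by linarith
      have i3: "l2_inner f (T f) \<le> 1"
      proof -
        have "l2_inner f (T f) \<le> (\<Sum>j. f j)"
          unfolding l2_inner_def
        proof (rule suminf_le)
          show "f j * T f j \<le> f j" for j
            using pvecs_nonneg[OF f, of j] pvecs_le_1[OF Tf, of j] by (simp add: mult_left_le)
        qed (intro summable_mult_sqsum pvecs_sqsum[OF f] pvecs_sqsum[OF Tf] pvecs_summable[OF f])+
        then show ?thesis by (simp add: pvecs_suminf[OF f])
      qed
      have "real n / (real n - 1) * l2_inner f (T f) = l2_inner f (T f) + l2_inner f (T f) / (real n - 1)"
        using n0 by (simp add: field_simps)
      also have "\<dots> \<le> l2_inner f (T f) + 1 / (real n - 1)"
        using n0 i3 by (simp add: divide_right_mono)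
      finally have "1 / real n \<le> l2_inner f f - real n / (real n - 1) * l2_inner f (T f)"
        using i1 i2 e(2) elim(1) unfolding D_def by (simp add: field_simps)
      then have "beta_L1 T n x = 0" by (intro beta_L1_eq_0[OF x n]) (simp add: f_def)
      then show "beta_L1 T n x \<le> C / real n" using C by simp
      have "\<bar>f k - p k\<bar> \<le> e" "\<bar>T f k - T p k\<bar> \<le> e"
        using pvecs_diff_le_suminf[OF f p, of k] pvecs_diff_le_suminf[OF Tf Tp, of k] fe Te by auto
      then have "p k - e \<le> f k" "T f k \<le> T p k + e" by linarith+
      then have "\<delta> - 2 * e \<le> f k - T f k" by (simp add: \<delta>_def)
      then have "\<delta> / 2 \<le> f k - T f k - 1 / real n"
        using e(3) elim(2) by linarith
      then show "beta_L2 T n x \<le> C / real n"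
        unfolding C_def f_def using \<delta> elim(3) by (intro beta_L2_le[OF x n]) auto
    qed
  qed
  have "\<forall>\<^sub>F n in sequentially. \<forall>x\<in>freq_data J n.
           (\<Sum>j. \<bar>emp n x j - p j\<bar>) \<le> e \<longrightarrow> beta_L d T n x \<le> C / real n" if "d \<in> {1, 2}" for d
    using main by eventually_elim (use that in \<open>auto simp: beta_L_def\<close>)
  then show ?thesis using C e(1) by blast
qed

subsection \<open>The error of the Grenander--Stone estimator\<close>

lemma stone_estimator_in_pvecs:
  assumes x: "x \<in> freq_data J n" and n: "1 \<le> n"
  shows "stone_estimator d T n x \<in> pvecs J"
proof -
  define b where "b = beta_L d T n x"
  have b: "0 \<le> b" "b \<le> 1" by (simp_all add: b_def beta_L_nonneg beta_L_le_1)
  have f: "emp n x \<in> pvecs J" by (rule emp_in_pvecs[OF x n])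
  have "(\<lambda>j. b * T (emp n x) j + (1 - b) * emp n x j) sums (b * 1 + (1 - b) * 1)"
    by (intro sums_add sums_mult) (use f T_pvecs[OF f] in \<open>auto simp: pvecs_def\<close>)
  then show ?thesis
    using b f T_pvecs[OF f] by (auto simp: stone_estimator_def pvecs_def b_def[symmetric])
qed

text \<open>The estimator moves from \<open>emp\<close> towards its projection by the fraction
  \<open>beta_L\<close>, over a distance of at most \<open>2\<close>. If \<open>p\<close> is a fixed
  point, convexity and the contraction remove this cost.\<close>

lemma stone_error_l1:
  assumes p: "p \<in> pvecs J" and x: "x \<in> freq_data J n" and n: "1 \<le> n"
  shows "(\<Sum>j. \<bar>stone_estimator d T n x j - p j\<bar>) \<le> (\<Sum>j. \<bar>emp n x j - p j\<bar>) + 2 * beta_L d T n x"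
    and "T p = p \<Longrightarrow> (\<Sum>j. \<bar>stone_estimator d T n x j - p j\<bar>) \<le> (\<Sum>j. \<bar>emp n x j - p j\<bar>)"
proof -
  define b where "b = beta_L d T n x"
  have b: "0 \<le> b" "b \<le> 1" by (simp_all add: b_def beta_L_nonneg beta_L_le_1)
  define f where "f = emp n x"
  have f: "f \<in> pvecs J" unfolding f_def by (rule emp_in_pvecs[OF x n])
  have Tf: "T f \<in> pvecs J" by (rule T_pvecs[OF f])
  have phi: "stone_estimator d T n x = (\<lambda>j. b * T f j + (1 - b) * f j)"
    by (simp add: stone_estimator_def b_def f_def)
  have phi_p: "summable (\<lambda>j. \<bar>(b * T f j + (1 - b) * f j) - p j\<bar>)"
    using pvecs_diff_abs_summable[OF stone_estimator_in_pvecs[OF x n, of d] p] by (simp add: phi)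
  have sm: "summable (\<lambda>j. \<bar>f j - p j\<bar>)" "summable (\<lambda>j. \<bar>T f j - f j\<bar>)" "summable (\<lambda>j. \<bar>T f j - p j\<bar>)"
    by (intro pvecs_diff_abs_summable[of _ J] f p Tf)+
  have "(\<Sum>j. \<bar>(b * T f j + (1 - b) * f j) - p j\<bar>) \<le> (\<Sum>j. \<bar>f j - p j\<bar> + b * \<bar>T f j - f j\<bar>)"
  proof (rule suminf_le[OF _ phi_p])
    show "\<bar>(b * T f j + (1 - b) * f j) - p j\<bar> \<le> \<bar>f j - p j\<bar> + b * \<bar>T f j - f j\<bar>" for j
    proof -
      have "(b * T f j + (1 - b) * f j) - p j = (f j - p j) + b * (T f j - f j)"
        by (simp add: algebra_simps)
      also have "\<bar>\<dots>\<bar> \<le> \<bar>f j - p j\<bar> + \<bar>b * (T f j - f j)\<bar>" by (rule abs_triangle_ineq)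
      finally show ?thesis using b by (simp add: abs_mult)
    qed
  qed (intro summable_add summable_mult sm)
  also have "\<dots> = (\<Sum>j. \<bar>f j - p j\<bar>) + b * (\<Sum>j. \<bar>T f j - f j\<bar>)"
    using suminf_add[OF sm(1) summable_mult[OF sm(2), of b]] suminf_mult[OF sm(2), of b] by simp
  also have "\<dots> \<le> (\<Sum>j. \<bar>f j - p j\<bar>) + b * 2"
    using pvecs_diff_abs_suminf_le[OF Tf f] b by (simp add: mult_left_mono)
  finally show "(\<Sum>j. \<bar>stone_estimator d T n x j - p j\<bar>) \<le> (\<Sum>j. \<bar>emp n x j - p j\<bar>) + 2 * beta_L d T n x"
    by (simp add: phi flip: f_def b_def)
  assume eq: "T p = p"
  have "(\<Sum>j. \<bar>(b * T f j + (1 - b) * f j) - p j\<bar>) \<le> (\<Sum>j. b * \<bar>T f j - p j\<bar> + (1 - b) * \<bar>f j - p j\<bar>)"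
  proof (rule suminf_le[OF _ phi_p])
    show "\<bar>(b * T f j + (1 - b) * f j) - p j\<bar> \<le> b * \<bar>T f j - p j\<bar> + (1 - b) * \<bar>f j - p j\<bar>" for j
    proof -
      have "(b * T f j + (1 - b) * f j) - p j = b * (T f j - p j) + (1 - b) * (f j - p j)"
        by (simp add: algebra_simps)
      also have "\<bar>\<dots>\<bar> \<le> \<bar>b * (T f j - p j)\<bar> + \<bar>(1 - b) * (f j - p j)\<bar>" by (rule abs_triangle_ineq)
      finally show ?thesis using b by (simp add: abs_mult)
    qed
  qed (intro summable_add summable_mult sm)
  also have "\<dots> = b * (\<Sum>j. \<bar>T f j - p j\<bar>) + (1 - b) * (\<Sum>j. \<bar>f j - p j\<bar>)"
    using suminf_add[OF summable_mult[OF sm(3), of b] summable_mult[OF sm(1), of "1 - b"]]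
      suminf_mult[OF sm(3), of b] suminf_mult[OF sm(1), of "1 - b"] by simp
  also have "\<dots> \<le> b * (\<Sum>j. \<bar>f j - p j\<bar>) + (1 - b) * (\<Sum>j. \<bar>f j - p j\<bar>)"
    using T_l1_contraction[OF f p] b by (intro add_right_mono mult_left_mono) (simp_all add: eq)
  also have "\<dots> = (\<Sum>j. \<bar>f j - p j\<bar>)" by (simp add: algebra_simps)
  finally show "(\<Sum>j. \<bar>stone_estimator d T n x j - p j\<bar>) \<le> (\<Sum>j. \<bar>emp n x j - p j\<bar>)"
    by (simp add: phi f_def)
qed

text \<open>The factor \<open>2\<close> comes from \<open>(u + v)^2 \<le> 2 * u^2 + 2 * v^2\<close>;
  the squared distance from \<open>emp\<close> to its projection is at most \<open>2\<close>, so the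
  second term is \<open>4 * beta^2\<close>.\<close>

lemma stone_error_l2:
  assumes p: "p \<in> pvecs J" and x: "x \<in> freq_data J n" and n: "1 \<le> n"
  shows "sq_dist p (stone_estimator d T n x) \<le> 2 * sq_dist p (emp n x) + (2 * beta_L d T n x)\<^sup>2"
    and "T p = p \<Longrightarrow> sq_dist p (stone_estimator d T n x) \<le> sq_dist p (emp n x)"
proof -
  define b where "b = beta_L d T n x"
  have b: "0 \<le> b" "b \<le> 1" by (simp_all add: b_def beta_L_nonneg beta_L_le_1)
  define f where "f = emp n x"
  have f: "f \<in> pvecs J" unfolding f_def by (rule emp_in_pvecs[OF x n])
  have Tf: "T f \<in> pvecs J" by (rule T_pvecs[OF f])
  have phi: "stone_estimator d T n x = (\<lambda>j. b * T f j + (1 - b) * f j)"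
    by (simp add: stone_estimator_def b_def f_def)
  have phi_p: "summable (\<lambda>j. ((b * T f j + (1 - b) * f j) - p j)\<^sup>2)"
    using pvecs_diff_sqsum[OF stone_estimator_in_pvecs[OF x n, of d] p] by (simp add: phi sqsum_def)
  have sm: "summable (\<lambda>j. (f j - p j)\<^sup>2)" "summable (\<lambda>j. (T f j - f j)\<^sup>2)" "summable (\<lambda>j. (T f j - p j)\<^sup>2)"
    using pvecs_diff_sqsum f p Tf by (auto simp: sqsum_def)
  have "(\<Sum>j. ((b * T f j + (1 - b) * f j) - p j)\<^sup>2) \<le> (\<Sum>j. 2 * (f j - p j)\<^sup>2 + (2 * b\<^sup>2) * (T f j - f j)\<^sup>2)"
  proof (rule suminf_le[OF _ phi_p])
    show "((b * T f j + (1 - b) * f j) - p j)\<^sup>2 \<le> 2 * (f j - p j)\<^sup>2 + (2 * b\<^sup>2) * (T f j - f j)\<^sup>2" for j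
    proof -
      have *: "(u + v)\<^sup>2 \<le> 2 * u\<^sup>2 + 2 * v\<^sup>2" for u v :: real
        using zero_le_power2[of "u - v"] by (simp add: power2_eq_square algebra_simps)
      have eq: "(b * T f j + (1 - b) * f j) - p j = (f j - p j) + b * (T f j - f j)"
        by (simp add: algebra_simps)
      show ?thesis
        unfolding eq using *[of "f j - p j" "b * (T f j - f j)"] by (simp add: power_mult_distrib)
    qed
  qed (intro summable_add summable_mult sm)
  also have "\<dots> = 2 * sq_dist p f + (2 * b\<^sup>2) * sq_dist f (T f)"
    using suminf_add[OF summable_mult[OF sm(1), of 2] summable_mult[OF sm(2), of "2 * b\<^sup>2"]]
      suminf_mult[OF sm(1), of 2] suminf_mult[OF sm(2), of "2 * b\<^sup>2"] by (simp add: sq_dist_def)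
  also have "\<dots> \<le> 2 * sq_dist p f + (2 * b\<^sup>2) * 2"
    using pvecs_sq_dist_le[OF Tf f] pvecs_diff_abs_suminf_le[OF Tf f]
    by (intro add_left_mono mult_left_mono) auto
  finally show "sq_dist p (stone_estimator d T n x) \<le> 2 * sq_dist p (emp n x) + (2 * beta_L d T n x)\<^sup>2"
    by (simp add: phi sq_dist_def power_mult_distrib flip: f_def b_def)
  assume eq: "T p = p"
  have "(\<Sum>j. ((b * T f j + (1 - b) * f j) - p j)\<^sup>2) \<le> (\<Sum>j. b * (T f j - p j)\<^sup>2 + (1 - b) * (f j - p j)\<^sup>2)"
  proof (rule suminf_le[OF _ phi_p])
    show "((b * T f j + (1 - b) * f j) - p j)\<^sup>2 \<le> b * (T f j - p j)\<^sup>2 + (1 - b) * (f j - p j)\<^sup>2" for j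
    proof -
      \<comment> \<open>This is exactly the convexity defect of the square at the two points
        \<open>T f j - p j\<close> and \<open>f j - p j\<close>.\<close>
      have "0 \<le> b * (1 - b) * (T f j - f j)\<^sup>2" using b by simp
      also have "\<dots> = b * (T f j - p j)\<^sup>2 + (1 - b) * (f j - p j)\<^sup>2 - ((b * T f j + (1 - b) * f j) - p j)\<^sup>2"
        by (simp add: power2_eq_square algebra_simps)
      finally show ?thesis by simp
    qed
  qed (intro summable_add summable_mult sm)
  also have "\<dots> = b * sq_dist p (T f) + (1 - b) * sq_dist p f"
    using suminf_add[OF summable_mult[OF sm(3), of b] summable_mult[OF sm(1), of "1 - b"]]
      suminf_mult[OF sm(3), of b] suminf_mult[OF sm(1), of "1 - b"] by (simp add: sq_dist_def)
  also have "\<dots> \<le> b * sq_dist p f + (1 - b) * sq_dist p f"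
    using T_sq_dist_contraction[OF f p] b by (intro add_right_mono mult_left_mono) (simp_all add: eq)
  also have "\<dots> = sq_dist p f" by (simp add: algebra_simps)
  finally show "sq_dist p (stone_estimator d T n x) \<le> sq_dist p (emp n x)"
    by (simp add: phi sq_dist_def f_def)
qed

text \<open>Both cases \<open>T p = p\<close> and \<open>T p \<noteq> p\<close> are merged into one
  deterministic estimate, which serves strong consistency and the rates alike.\<close>

lemma stone_error:
  assumes p: "p \<in> pvecs J" and d: "d \<in> {1, 2}"
  shows "\<exists>C\<ge>0. \<exists>e>0. \<forall>\<^sub>F n in sequentially. \<forall>x\<in>freq_data J n.
    (\<Sum>j. \<bar>emp n x j - p j\<bar>) \<le> e \<longrightarrow>
      lnorm 1 (\<lambda>j. stone_estimator d T n x j - p j) \<le> lnorm 1 (\<lambda>j. emp n x j - p j) + C / real n \<and>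
      lnorm 2 (\<lambda>j. stone_estimator d T n x j - p j) \<le> 2 * lnorm 2 (\<lambda>j. emp n x j - p j) + C / real n"
proof -
  have "\<exists>C\<ge>0. \<exists>e>0. \<forall>\<^sub>F n in sequentially. \<forall>x\<in>freq_data J n.
    (\<Sum>j. \<bar>emp n x j - p j\<bar>) \<le> e \<longrightarrow> T p = p \<or> beta_L d T n x \<le> C / real n"
  proof (cases "T p = p")
    case True
    then show ?thesis by (intro exI[of _ 0] exI[of _ 1] conjI) simp_all
  next
    case False
    obtain C e where "0 \<le> C" "0 < e" and ev: "\<forall>d\<in>{1, 2}. \<forall>\<^sub>F n in sequentially. \<forall>x\<in>freq_data J n.
           (\<Sum>j. \<bar>emp n x j - p j\<bar>) \<le> e \<longrightarrow> beta_L d T n x \<le> C / real n"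
      using beta_L_le[OF p False] by blast
    then show ?thesis using bspec[OF ev d] False by (intro exI[of _ C] exI[of _ e] conjI) simp_all
  qed
  then obtain C e where Ce: "0 \<le> C" "0 < e" and ev: "\<forall>\<^sub>F n in sequentially. \<forall>x\<in>freq_data J n.
    (\<Sum>j. \<bar>emp n x j - p j\<bar>) \<le> e \<longrightarrow> T p = p \<or> beta_L d T n x \<le> C / real n" by blast
  have "\<forall>\<^sub>F n in sequentially. \<forall>x\<in>freq_data J n.
    (\<Sum>j. \<bar>emp n x j - p j\<bar>) \<le> e \<longrightarrow>
      lnorm 1 (\<lambda>j. stone_estimator d T n x j - p j) \<le> lnorm 1 (\<lambda>j. emp n x j - p j) + 2 * C / real n \<and>
      lnorm 2 (\<lambda>j. stone_estimator d T n x j - p j) \<le> 2 * lnorm 2 (\<lambda>j. emp n x j - p j) + 2 * C / real n"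
    using ev eventually_ge_at_top[of 1]
  proof eventually_elim
    case (elim n)
    show ?case
    proof (intro ballI impI)
      fix x assume x: "x \<in> freq_data J n" and xe: "(\<Sum>j. \<bar>emp n x j - p j\<bar>) \<le> e"
      note n = elim(2)
      have f: "emp n x \<in> pvecs J" by (rule emp_in_pvecs[OF x n])
      define S where "S = sq_dist p (emp n x)"
      have S: "0 \<le> S"
        unfolding S_def sq_dist_eq by (intro l2_inner_self_nonneg pvecs_diff_sqsum[of _ J] f p)
      have Cn: "0 \<le> 2 * C / real n" using Ce by simp
      consider "T p = p" | "beta_L d T n x \<le> C / real n" using elim(1) x xe by blast
      then show "lnorm 1 (\<lambda>j. stone_estimator d T n x j - p j) \<le> lnorm 1 (\<lambda>j. emp n x j - p j) + 2 * C / real n \<and>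
        lnorm 2 (\<lambda>j. stone_estimator d T n x j - p j) \<le> 2 * lnorm 2 (\<lambda>j. emp n x j - p j) + 2 * C / real n"
      proof cases
        case 1
        have "sqrt (sq_dist p (stone_estimator d T n x)) \<le> sqrt S"
          unfolding S_def using stone_error_l2(2)[OF p x n 1] by simp
        also have "\<dots> \<le> 2 * sqrt S" using S by simp
        finally show ?thesis
          using stone_error_l1(2)[OF p x n 1, of d] Cn
          by (simp add: lnorm_1 lnorm_2 S_def sq_dist_def)
      next
        case 2
        have b0: "0 \<le> 2 * beta_L d T n x" by (simp add: beta_L_nonneg)
        have "sqrt (sq_dist p (stone_estimator d T n x)) \<le> sqrt (2 * S + (2 * beta_L d T n x)\<^sup>2)"
          unfolding S_def using stone_error_l2(1)[OF p x n] by simp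
        also have "\<dots> \<le> sqrt (2 * S) + sqrt ((2 * beta_L d T n x)\<^sup>2)"
          using S by (intro sqrt_add_le_add_sqrt) auto
        also have "sqrt ((2 * beta_L d T n x)\<^sup>2) = 2 * beta_L d T n x"
          using b0 by (simp only: real_sqrt_abs abs_of_nonneg)
        \<comment> \<open>Rounding \<open>2\<close> up to \<open>4\<close> under the root gives the
          integer factor in the claim.\<close>
        also have "sqrt (2 * S) + 2 * beta_L d T n x \<le> sqrt (4 * S) + 2 * beta_L d T n x"
          using S by simp
        also have "sqrt (4 * S) = 2 * sqrt S" by (simp add: real_sqrt_mult)
        finally show ?thesis
          using stone_error_l1(1)[OF p x n, of d] 2
          by (simp add: lnorm_1 lnorm_2 S_def sq_dist_def)
      qed
    qed
  qed
  then show ?thesis using Ce by (intro exI[of _ "2 * C"]) auto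
qed

end

subsection \<open>Stochastic boundedness\<close>

context prob_space
begin

text \<open>Dominated convergence for the indicators of the deviation events.\<close>

lemma AE_tendsto_zero_imp_prob:
  fixes U :: "nat \<Rightarrow> 'a \<Rightarrow> real"
  assumes [measurable]: "\<And>n. U n \<in> borel_measurable M"
    and lim: "AE \<omega> in M. (\<lambda>n. U n \<omega>) \<longlonglongrightarrow> 0" and e: "0 < e"
  shows "(\<lambda>n. prob {\<omega> \<in> space M. e < U n \<omega>}) \<longlonglongrightarrow> 0"
proof -
  have "(\<lambda>n. \<integral>\<omega>. indicator {\<omega> \<in> space M. e < U n \<omega>} \<omega> \<partial>M) \<longlonglongrightarrow> (\<integral>\<omega>. (0 :: real) \<partial>M)"
  proof (rule integral_dominated_convergence[where w = "\<lambda>_. 1"])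
    show "AE \<omega> in M. (\<lambda>n. indicator {\<omega> \<in> space M. e < U n \<omega>} \<omega> :: real) \<longlonglongrightarrow> 0"
      using lim
    proof eventually_elim
      case (elim \<omega>)
      have "\<forall>\<^sub>F n in sequentially. U n \<omega> < e" using order_tendstoD(2)[OF elim e] .
      then have "\<forall>\<^sub>F n in sequentially. indicator {\<omega> \<in> space M. e < U n \<omega>} \<omega> = (0 :: real)"
        by eventually_elim auto
      then show ?case by (rule tendsto_eventually)
    qed
  qed auto
  then show ?thesis by simp
qed

text \<open>Markov's inequality controls \<open>A n\<close>, while the complement of
  \<open>E n\<close>, where \<open>bound\<close> says nothing, has vanishing probability. Stating
  the mean as a nonnegative integral lets series be integrated termwise in the applications.\<close>

lemma bigO_prob_zeroI:
  fixes b A :: "nat \<Rightarrow> 'a \<Rightarrow> real"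
  assumes b: "\<And>n. b n \<in> borel_measurable M" and A[measurable]: "\<And>n. A n \<in> borel_measurable M"
    and mean: "\<And>n. 1 \<le> n \<Longrightarrow> (\<integral>\<^sup>+\<omega>. ennreal (A n \<omega>) \<partial>M) \<le> ennreal K" and K: "0 \<le> K"
    and E[measurable]: "\<And>n. E n \<in> events" and E0: "(\<lambda>n. prob (space M - E n)) \<longlonglongrightarrow> 0"
    and bound: "\<forall>\<^sub>F n in sequentially. \<forall>\<omega>\<in>E n. \<bar>b n \<omega>\<bar> \<le> 2 * A n \<omega> + C" and C: "0 \<le> C"
  shows "bigO_prob M b 0"
  unfolding bigO_prob_def
proof (intro conjI allI impI b)
  fix \<epsilon> :: real assume \<epsilon>: "0 < \<epsilon>"
  \<comment> \<open>Makes \<open>K / c < \<epsilon> / 2\<close> and stays positive for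
    \<open>K = 0\<close>. On \<open>E n\<close>, exceeding \<open>K' = C + 2 * c\<close> forces
    \<open>A n > c\<close>.\<close>
  define c where "c = 2 * K / \<epsilon> + 1"
  have c: "0 < c" using K \<epsilon> by (simp add: c_def add_nonneg_pos)
  have Kc: "K / c < \<epsilon> / 2" using c \<epsilon> by (simp add: c_def field_simps)
  define K' where "K' = C + 2 * c"
  have K': "0 < K'" using C c by (simp add: K'_def)
  have "\<forall>\<^sub>F n in sequentially. prob (space M - E n) < \<epsilon> / 2"
    using order_tendstoD(2)[OF E0, of "\<epsilon> / 2"] \<epsilon> by simp
  then have "\<forall>\<^sub>F n in sequentially. prob {\<omega> \<in> space M. real n powr (- 0) * \<bar>b n \<omega>\<bar> > K'} < \<epsilon>"
    using bound eventually_ge_at_top[of 1]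
  proof eventually_elim
    case (elim n)
    note [measurable] = b
    have "emeasure M {\<omega> \<in> space M. 1 \<le> ennreal (1 / c) * ennreal (A n \<omega>)}
        \<le> ennreal (1 / c) * (\<integral>\<^sup>+\<omega>. ennreal (A n \<omega>) * indicator (space M) \<omega> \<partial>M)"
      by (rule nn_integral_Markov_inequality) auto
    also have "(\<integral>\<^sup>+\<omega>. ennreal (A n \<omega>) * indicator (space M) \<omega> \<partial>M) = (\<integral>\<^sup>+\<omega>. ennreal (A n \<omega>) \<partial>M)"
      by (rule nn_integral_cong) simp
    also have "ennreal (1 / c) * \<dots> \<le> ennreal (1 / c) * ennreal K"
      using mean elim(3) by (intro mult_left_mono) auto
    also have "\<dots> = ennreal (K / c)" using c K by (simp flip: ennreal_mult)
    finally have m: "prob {\<omega> \<in> space M. 1 \<le> ennreal (1 / c) * ennreal (A n \<omega>)} \<le> K / c"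
      using K c by (simp add: emeasure_eq_measure)
    have "{\<omega> \<in> space M. real n powr (- 0) * \<bar>b n \<omega>\<bar> > K'}
        \<subseteq> (space M - E n) \<union> {\<omega> \<in> space M. 1 \<le> ennreal (1 / c) * ennreal (A n \<omega>)}"
    proof safe
      fix \<omega> assume \<omega>: "\<omega> \<in> space M" "\<omega> \<in> E n" and gt: "K' < real n powr - 0 * \<bar>b n \<omega>\<bar>"
      have "K' < 2 * A n \<omega> + C" using gt elim(2,3) \<omega> by force
      then have "c \<le> A n \<omega>" by (simp add: K'_def)
      then have "1 \<le> 1 / c * A n \<omega>" using c by simp
      then have "ennreal 1 \<le> ennreal (1 / c * A n \<omega>)" by (rule ennreal_leI)
      then show "1 \<le> ennreal (1 / c) * ennreal (A n \<omega>)"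
        using c \<open>c \<le> A n \<omega>\<close> by (simp flip: ennreal_mult)
    qed
    then have "prob {\<omega> \<in> space M. real n powr (- 0) * \<bar>b n \<omega>\<bar> > K'}
        \<le> prob ((space M - E n) \<union> {\<omega> \<in> space M. 1 \<le> ennreal (1 / c) * ennreal (A n \<omega>)})"
      by (intro finite_measure_mono) auto
    also have "\<dots> \<le> prob (space M - E n) + prob {\<omega> \<in> space M. 1 \<le> ennreal (1 / c) * ennreal (A n \<omega>)}"
      by (intro measure_Un_le) auto
    finally show ?case using m Kc elim(1) by linarith
  qed
  then obtain N where N: "\<And>n. n \<ge> N \<Longrightarrow> prob {\<omega> \<in> space M. real n powr (- 0) * \<bar>b n \<omega>\<bar> > K'} < \<epsilon>"
    by (auto simp: eventually_sequentially)
  show "\<exists>K>0. \<exists>N>0. \<forall>n>N. prob {\<omega> \<in> space M. real n powr (- 0) * \<bar>b n \<omega>\<bar> > K} < \<epsilon>"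
  proof (intro exI conjI allI impI)
    show "prob {\<omega> \<in> space M. real n powr (- 0) * \<bar>b n \<omega>\<bar> > K'} < \<epsilon>" if "Suc N < n" for n
      by (rule N) (use that in simp)
  qed (use K' in simp_all)
qed

end

text \<open>Data vectors are finite lists padded with zeros. Countability is what makes every
  statistic of the counts measurable.\<close>

lemma countable_freq_data: "countable (freq_data J n)"
proof (rule countable_subset)
  show "freq_data J n \<subseteq> range (\<lambda>l j. if j < length l then l ! j else 0)"
  proof
    fix x assume "x \<in> freq_data J n"
    then have "finite {j. x j > 0}" by (simp add: freq_data_def)
    then obtain m where m: "\<And>j. x j > 0 \<Longrightarrow> j < m"
      by (metis finite_nat_set_iff_bounded mem_Collect_eq)
    then have "x = (\<lambda>j. if j < length (map x [0..<m]) then map x [0..<m] ! j else 0)"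
      by (auto simp: fun_eq_iff)
    then show "x \<in> range (\<lambda>l j. if j < length l then l ! j else 0)" by blast
  qed
qed simp

text \<open>Scheffe's lemma: \<open>\<bar>f - p\<bar> = 2 (p - f)\<^sup>+ + (f - p)\<close>, where the positive part is dominated by \<open>p\<close>
  and the last term sums to \<open>0\<close>.\<close>

lemma pvecs_pointwise_imp_l1:
  assumes p: "p \<in> pvecs J" and f: "\<forall>\<^sub>F n in sequentially. f n \<in> pvecs J"
    and lim: "\<And>j. (\<lambda>n. f n j) \<longlonglongrightarrow> p j"
  shows "(\<lambda>n. \<Sum>j. \<bar>f n j - p j\<bar>) \<longlonglongrightarrow> 0"
proof -
  have b: "\<bar>max 0 (p j - f n j)\<bar> \<le> p j" if "f n \<in> pvecs J" for n j
    using pvecs_nonneg[OF that, of j] pvecs_nonneg[OF p, of j] by simp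
  have ev: "\<forall>\<^sub>F n in sequentially. \<forall>j. norm (max 0 (p j - f n j)) \<le> p j"
    using f by eventually_elim (use b in auto)
  have "((\<lambda>n. suminf (\<lambda>j. max 0 (p j - f n j))) \<longlongrightarrow> suminf (\<lambda>j. 0)) sequentially"
  proof (rule tannerys_theorem[THEN conjunct2, THEN conjunct2])
    show "((\<lambda>n. max 0 (p j - f n j)) \<longlongrightarrow> 0) sequentially" for j
      using tendsto_max[OF tendsto_const[of 0] tendsto_diff[OF tendsto_const[of "p j"] lim[of j]]] by simp
    show "\<forall>\<^sub>F (j, n) in at_top \<times>\<^sub>F sequentially. norm (max 0 (p j - f n j)) \<le> p j"
      using eventually_compose_filterlim[OF ev filterlim_snd] by eventually_elim auto
  qed (use pvecs_summable[OF p] in auto)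
  then have "(\<lambda>n. 2 * (\<Sum>j. max 0 (p j - f n j))) \<longlonglongrightarrow> 0" using tendsto_mult_right_zero by force
  moreover have "\<forall>\<^sub>F n in sequentially. 2 * (\<Sum>j. max 0 (p j - f n j)) = (\<Sum>j. \<bar>f n j - p j\<bar>)"
    using f
  proof eventually_elim
    case (elim n)
    have sm: "summable (\<lambda>j. max 0 (p j - f n j))"
      by (rule summable_comparison_test'[OF pvecs_summable[OF p], of 0]) (use b[OF elim] in auto)
    have "(\<lambda>j. 2 * max 0 (p j - f n j) + (f n j - p j)) sums (2 * (\<Sum>j. max 0 (p j - f n j)) + (1 - 1))"
      using elim p by (intro sums_add sums_mult sums_diff summable_sums[OF sm]) (auto simp: pvecs_def)
    moreover have "(\<lambda>j. 2 * max 0 (p j - f n j) + (f n j - p j)) = (\<lambda>j. \<bar>f n j - p j\<bar>)"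
      by (intro ext) (simp add: max_def)
    ultimately show ?case by (simp add: sums_iff)
  qed
  ultimately show ?thesis by (rule Lim_transform_eventually)
qed

subsection \<open>The empirical distribution of an i.i.d. sample\<close>

locale iid_sample = prob_space M for M :: "'w measure" +
  fixes J :: "nat set" and S :: "'a set" and s :: "nat \<Rightarrow> 'a" and z :: "nat \<Rightarrow> 'w \<Rightarrow> 'a"
    and p :: "nat \<Rightarrow> real"
  assumes enum: "bij_betw s J S" and p: "p \<in> pvecs J"
    and indep: "indep_vars (\<lambda>_. count_space S) z {1..}"
    and pmf: "\<And>i j. 1 \<le> i \<Longrightarrow> j \<in> J \<Longrightarrow> prob {\<omega> \<in> space M. z i \<omega> = s j} = p j"
begin

abbreviation "X \<equiv> counts J s z"

definition hit :: "nat \<Rightarrow> nat \<Rightarrow> 'w \<Rightarrow> real" where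
  "hit j i \<omega> = indicator {s j} (z i \<omega>)"

lemma z_measurable: "1 \<le> i \<Longrightarrow> z i \<in> measurable M (count_space S)"
  using indep by (auto simp: indep_vars_def2)

lemma z_in: "1 \<le> i \<Longrightarrow> \<omega> \<in> space M \<Longrightarrow> z i \<omega> \<in> S"
  using measurable_space[OF z_measurable] by auto

lemma hit_measurable: "1 \<le> i \<Longrightarrow> hit j i \<in> borel_measurable M"
  unfolding hit_def by (rule measurable_compose[OF z_measurable]) simp_all

lemma hit_indep: "indep_vars (\<lambda>_. borel) (hit j) {1..n}"
proof -
  have "indep_vars (\<lambda>_. borel) (\<lambda>i \<omega>. (\<lambda>_. indicator {s j}) i (z i \<omega>) :: real) {1..n}"
    by (rule indep_vars_compose2[OF indep_vars_subset[OF indep]]) auto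
  then show ?thesis by (simp add: hit_def[abs_def])
qed

lemma expectation_hit: "1 \<le> i \<Longrightarrow> j \<in> J \<Longrightarrow> expectation (hit j i) = p j"
proof -
  assume ij: "1 \<le> i" "j \<in> J"
  have "expectation (hit j i) = expectation (indicator {\<omega> \<in> space M. z i \<omega> = s j})"
    by (rule Bochner_Integration.integral_cong) (auto simp: hit_def indicator_def)
  also have "\<dots> = prob ({\<omega> \<in> space M. z i \<omega> = s j} \<inter> space M)" by simp
  also have "{\<omega> \<in> space M. z i \<omega> = s j} \<inter> space M = {\<omega> \<in> space M. z i \<omega> = s j}" by blast
  finally show ?thesis using pmf[OF ij] by simp
qed

lemma counts_eq_sum_hit: "j \<in> J \<Longrightarrow> real (X n \<omega> j) = (\<Sum>i=1..n. hit j i \<omega>)"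
proof -
  assume j: "j \<in> J"
  have "(\<Sum>i=1..n. hit j i \<omega>) = (\<Sum>i\<in>{i \<in> {1..n}. z i \<omega> = s j}. 1)"
    unfolding hit_def by (intro sum.mono_neutral_cong_right) (auto simp: indicator_def)
  then show ?thesis using j by (simp add: counts_def)
qed

lemma counts_in_freq_data:
  assumes \<omega>: "\<omega> \<in> space M"
  shows "X n \<omega> \<in> freq_data J n"
proof -
  \<comment> \<open>On indices, the counts are the fibre sizes of \<open>idx\<close> on
    \<open>{1..n}\<close>, so they add up to \<open>n\<close>.\<close>
  define idx where "idx i = inv_into J s (z i \<omega>)" for i
  have idx: "idx i \<in> J" "s (idx i) = z i \<omega>" if "1 \<le> i" for i
    using z_in[OF that \<omega>] enum unfolding idx_def
    by (auto simp: bij_betw_def intro: inv_into_into f_inv_into_f)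
  have eq: "{i \<in> {1..n}. z i \<omega> = s j} = {i \<in> {1..n}. idx i = j}" if "j \<in> J" for j
    using idx that enum by (auto simp: bij_betw_def inj_on_def)
  have X: "X n \<omega> j = (if j \<in> J then card {i \<in> {1..n}. idx i = j} else 0)" for j
    unfolding counts_def using eq by (auto simp del: atLeastAtMost_iff)
  have supp: "{j. X n \<omega> j > 0} = idx ` {1..n}"
    using idx by (auto simp: X card_gt_0_iff)
  have "(\<Sum>j\<in>idx ` {1..n}. X n \<omega> j) = (\<Sum>j\<in>idx ` {1..n}. \<Sum>i\<in>{i \<in> {1..n}. idx i = j}. 1)"
    using idx by (intro sum.cong) (auto simp: X)
  also have "\<dots> = n" by (subst sum.group) auto
  finally show ?thesis using idx by (auto simp: freq_data_def supp)
qed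

text \<open>\<open>X n\<close> has countably many values with measurable preimages, hence is
  measurable into a discrete space, on which every \<open>F\<close> is measurable. So no regularity
  of \<open>arg_min\<close> or of the selected parameter has to be studied.\<close>

lemma statistic_measurable:
  fixes F :: "(nat \<Rightarrow> nat) \<Rightarrow> real"
  shows "(\<lambda>\<omega>. F (X n \<omega>)) \<in> borel_measurable M"
proof -
  have "{\<omega> \<in> space M. X n \<omega> j = k} \<in> events" for j k
  proof (cases "j \<in> J")
    case True
    have [measurable]: "(\<lambda>\<omega>. \<Sum>i=1..n. hit j i \<omega>) \<in> borel_measurable M"
      by (intro borel_measurable_sum hit_measurable) auto
    have "{\<omega> \<in> space M. X n \<omega> j = k} = {\<omega> \<in> space M. (\<Sum>i=1..n. hit j i \<omega>) = real k}"
      unfolding counts_eq_sum_hit[OF True, symmetric] by simp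
    also have "\<dots> \<in> events" by measurable
    finally show ?thesis .
  qed (auto simp: counts_def)
  then have "{\<omega> \<in> space M. \<forall>j. X n \<omega> j = x j} \<in> events" for x
    by (intro sets.sets_Collect_countable_All) auto
  moreover have "X n -` {x} \<inter> space M = {\<omega> \<in> space M. \<forall>j. X n \<omega> j = x j}" for x
    by (auto simp: fun_eq_iff)
  ultimately have "X n \<in> measurable M (count_space (freq_data J n))"
    by (subst measurable_count_space_eq_countable[OF countable_freq_data])
       (auto intro: counts_in_freq_data)
  then show ?thesis by (rule measurable_compose) simp
qed

text \<open>The variance \<open>n * p j * (1 - p j)\<close> of a binomial count: independence kills
  the mixed terms, and the factor \<open>1 - p j\<close> is dropped.\<close>

lemma expectation_sq_le:
  assumes j: "j \<in> J"
  shows "integrable M (\<lambda>\<omega>. (\<Sum>i=1..n. hit j i \<omega> - p j)\<^sup>2)"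
    and "expectation (\<lambda>\<omega>. (\<Sum>i=1..n. hit j i \<omega> - p j)\<^sup>2) \<le> real n * p j"
proof -
  define Z where "Z = (\<lambda>i \<omega>. hit j i \<omega> - p j)"
  have p01: "0 \<le> p j" "p j \<le> 1" using pvecs_nonneg[OF p] pvecs_le_1[OF p] by auto
  have Zm[measurable]: "Z i \<in> borel_measurable M" if "i \<in> {1..n}" for i
    unfolding Z_def using hit_measurable[of i j] that by auto
  have Zb: "\<bar>Z i \<omega>\<bar> \<le> 1" for i \<omega>
    using p01 by (auto simp: Z_def hit_def indicator_def)
  have Zi: "integrable M (Z i)" if "i \<in> {1..n}" for i
    by (rule integrable_const_bound[of _ 1]) (use Zb Zm[OF that] in auto)
  have hi: "integrable M (hit j i)" if "i \<in> {1..n}" for i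
    by (rule integrable_const_bound[of _ 1])
       (use hit_measurable[of i j] that in \<open>auto simp: hit_def indicator_def\<close>)
  have EZ: "expectation (Z i) = 0" if "i \<in> {1..n}" for i
    using expectation_hit[OF _ j, of i] that hi[OF that] by (simp add: Z_def prob_space)
  have ZZi: "integrable M (\<lambda>\<omega>. Z i \<omega> * Z k \<omega>)" if "i \<in> {1..n}" "k \<in> {1..n}" for i k
  proof (rule integrable_const_bound[of _ 1])
    show "AE \<omega> in M. norm (Z i \<omega> * Z k \<omega>) \<le> 1"
      using mult_mono[OF Zb Zb] by (auto simp: abs_mult)
  qed (use Zm that in auto)
  have Zind: "indep_vars (\<lambda>_. borel) Z {1..n}"
    unfolding Z_def by (rule indep_vars_compose2[OF hit_indep]) auto
  have off: "expectation (\<lambda>\<omega>. Z i \<omega> * Z k \<omega>) = 0" if "i \<in> {1..n}" "k \<in> {1..n}" "i \<noteq> k" for i k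
  proof -
    have "expectation (\<lambda>\<omega>. \<Prod>l\<in>{i, k}. Z l \<omega>) = (\<Prod>l\<in>{i, k}. expectation (Z l))"
      using that by (intro indep_vars_lebesgue_integral indep_vars_subset[OF Zind] Zi) auto
    then show ?thesis using that EZ by simp
  qed
  have diag: "expectation (\<lambda>\<omega>. Z i \<omega> * Z i \<omega>) \<le> p j" if "i \<in> {1..n}" for i
  proof -
    \<comment> \<open>\<open>hit\<close> takes the values \<open>0\<close> and \<open>1\<close>, so
      its square is itself and the expression becomes affine in \<open>hit\<close>.\<close>
    have "Z i \<omega> * Z i \<omega> = (1 - 2 * p j) * hit j i \<omega> + p j * p j" for \<omega>
      by (auto simp: Z_def hit_def indicator_def algebra_simps)
    then have "expectation (\<lambda>\<omega>. Z i \<omega> * Z i \<omega>) = (1 - 2 * p j) * p j + p j * p j"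
      using hi[OF that] expectation_hit[OF _ j, of i] that by (simp add: prob_space)
    also have "\<dots> \<le> p j" using p01 by (simp add: algebra_simps)
    finally show ?thesis .
  qed
  have sq: "(\<lambda>\<omega>. (\<Sum>i=1..n. hit j i \<omega> - p j)\<^sup>2) = (\<lambda>\<omega>. \<Sum>i=1..n. \<Sum>k=1..n. Z i \<omega> * Z k \<omega>)"
    by (simp add: Z_def power2_eq_square sum_product)
  show "integrable M (\<lambda>\<omega>. (\<Sum>i=1..n. hit j i \<omega> - p j)\<^sup>2)"
    unfolding sq by (intro Bochner_Integration.integrable_sum ZZi)
  have "expectation (\<lambda>\<omega>. \<Sum>i=1..n. \<Sum>k=1..n. Z i \<omega> * Z k \<omega>)
      = (\<Sum>i=1..n. expectation (\<lambda>\<omega>. \<Sum>k=1..n. Z i \<omega> * Z k \<omega>))"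
    by (intro Bochner_Integration.integral_sum Bochner_Integration.integrable_sum ZZi)
  also have "\<dots> = (\<Sum>i=1..n. \<Sum>k=1..n. expectation (\<lambda>\<omega>. Z i \<omega> * Z k \<omega>))"
    by (intro sum.cong refl Bochner_Integration.integral_sum ZZi)
  also have "\<dots> = (\<Sum>i=1..n. expectation (\<lambda>\<omega>. Z i \<omega> * Z i \<omega>))"
  proof (intro sum.cong refl)
    fix i assume i: "i \<in> {1..n}"
    have "(\<Sum>k=1..n. expectation (\<lambda>\<omega>. Z i \<omega> * Z k \<omega>)) = (\<Sum>k\<in>{i}. expectation (\<lambda>\<omega>. Z i \<omega> * Z k \<omega>))"
      using i off[OF i] by (intro sum.mono_neutral_right) auto
    then show "(\<Sum>k=1..n. expectation (\<lambda>\<omega>. Z i \<omega> * Z k \<omega>)) = expectation (\<lambda>\<omega>. Z i \<omega> * Z i \<omega>)" by simp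
  qed
  also have "\<dots> \<le> (\<Sum>i=1..n. p j)" by (rule sum_mono) (rule diag)
  finally show "expectation (\<lambda>\<omega>. (\<Sum>i=1..n. hit j i \<omega> - p j)\<^sup>2) \<le> real n * p j"
    unfolding sq by simp
qed

lemma emp_minus_p:
  assumes "j \<in> J" "1 \<le> n"
  shows "emp n (X n \<omega>) j - p j = (\<Sum>i=1..n. hit j i \<omega> - p j) / real n"
  using assms by (simp add: emp_def counts_eq_sum_hit sum_subtractf field_simps)

lemma emp_outside: "j \<notin> J \<Longrightarrow> emp n (X n \<omega>) j - p j = 0"
  using p by (simp add: emp_def counts_def pvecs_outside)

lemma emp_variance:
  assumes n: "1 \<le> n"
  shows "integrable M (\<lambda>\<omega>. (emp n (X n \<omega>) j - p j)\<^sup>2)"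
    and "expectation (\<lambda>\<omega>. (emp n (X n \<omega>) j - p j)\<^sup>2) \<le> p j / real n"
proof -
  have "integrable M (\<lambda>\<omega>. (emp n (X n \<omega>) j - p j)\<^sup>2) \<and>
    expectation (\<lambda>\<omega>. (emp n (X n \<omega>) j - p j)\<^sup>2) \<le> p j / real n"
  proof (cases "j \<in> J")
    case True
    have "expectation (\<lambda>\<omega>. (\<Sum>i=1..n. hit j i \<omega> - p j)\<^sup>2) / (real n)\<^sup>2 \<le> real n * p j / (real n)\<^sup>2"
      by (intro divide_right_mono expectation_sq_le True) auto
    then show ?thesis
      using n expectation_sq_le(1)[OF True, of n]
      by (simp add: emp_minus_p[OF True n] power_divide power2_eq_square)
  next
    case False
    then show ?thesis using n pvecs_nonneg[OF p, of j] by (simp add: emp_outside)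
  qed
  then show "integrable M (\<lambda>\<omega>. (emp n (X n \<omega>) j - p j)\<^sup>2)"
    and "expectation (\<lambda>\<omega>. (emp n (X n \<omega>) j - p j)\<^sup>2) \<le> p j / real n" by auto
qed

text \<open>Nonnegativity of the variance of the absolute deviation serves as Jensen's inequality.
  The square root of \<open>p j\<close> is the source of the summability condition for the
  \<open>\<ell>\<^sub>1\<close> rate.\<close>

lemma emp_abs_deviation:
  assumes n: "1 \<le> n"
  shows "integrable M (\<lambda>\<omega>. \<bar>emp n (X n \<omega>) j - p j\<bar>)"
    and "expectation (\<lambda>\<omega>. \<bar>emp n (X n \<omega>) j - p j\<bar>) \<le> sqrt (p j) / sqrt (real n)"
proof -
  define D where "D = (\<lambda>\<omega>. \<bar>emp n (X n \<omega>) j - p j\<bar>)"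
  have Dm: "D \<in> borel_measurable M"
    unfolding D_def by (rule statistic_measurable[of "\<lambda>x. \<bar>emp n x j - p j\<bar>"])
  show D: "integrable M (\<lambda>\<omega>. \<bar>emp n (X n \<omega>) j - p j\<bar>)"
  proof (rule Bochner_Integration.integrable_bound)
    show "integrable M (\<lambda>\<omega>. 1 + (emp n (X n \<omega>) j - p j)\<^sup>2)"
      using emp_variance(1)[OF n] by simp
    have "\<bar>y\<bar> \<le> 1 + y\<^sup>2" for y :: real
      using zero_le_power2[of "\<bar>y\<bar> - 1"] by (simp add: power2_diff)
    then show "AE \<omega> in M. norm \<bar>emp n (X n \<omega>) j - p j\<bar> \<le> norm (1 + (emp n (X n \<omega>) j - p j)\<^sup>2)"
      by auto
  qed (use Dm in \<open>simp add: D_def\<close>)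
  have "0 \<le> variance D" by (rule variance_positive)
  also have "variance D = expectation (\<lambda>\<omega>. (D \<omega>)\<^sup>2) - (expectation D)\<^sup>2"
    by (rule variance_eq) (use D emp_variance(1)[OF n] in \<open>simp_all add: D_def\<close>)
  finally have "(expectation D)\<^sup>2 \<le> p j / real n"
    using emp_variance(2)[OF n, of j] by (simp add: D_def)
  then have "\<bar>expectation D\<bar> \<le> sqrt (p j / real n)"
    using real_sqrt_le_mono by fastforce
  then show "expectation (\<lambda>\<omega>. \<bar>emp n (X n \<omega>) j - p j\<bar>) \<le> sqrt (p j) / sqrt (real n)"
    by (simp add: D_def real_sqrt_divide)
qed

text \<open>Termwise integration: the variances scaled by \<open>n\<close> are at most
  \<open>p j\<close>, which sum to \<open>1\<close>.\<close>

lemma nn_integral_sq_dist_emp: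
  assumes n: "1 \<le> n"
  shows "(\<integral>\<^sup>+\<omega>. ennreal (real n * sq_dist p (emp n (X n \<omega>))) \<partial>M) \<le> 1"
proof -
  have "(\<integral>\<^sup>+\<omega>. ennreal (real n * sq_dist p (emp n (X n \<omega>))) \<partial>M)
      = (\<integral>\<^sup>+\<omega>. (\<Sum>j. ennreal (real n * (emp n (X n \<omega>) j - p j)\<^sup>2)) \<partial>M)"
  proof (rule nn_integral_cong)
    fix \<omega> assume "\<omega> \<in> space M"
    then have sm: "summable (\<lambda>j. (emp n (X n \<omega>) j - p j)\<^sup>2)"
      using pvecs_diff_sqsum[OF emp_in_pvecs[OF counts_in_freq_data n] p] by (simp add: sqsum_def)
    show "ennreal (real n * sq_dist p (emp n (X n \<omega>))) = (\<Sum>j. ennreal (real n * (emp n (X n \<omega>) j - p j)\<^sup>2))"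
      unfolding sq_dist_def suminf_mult[OF sm, symmetric]
      by (rule suminf_ennreal2[symmetric]) (use summable_mult[OF sm] in auto)
  qed
  also have "\<dots> = (\<Sum>j. \<integral>\<^sup>+\<omega>. ennreal (real n * (emp n (X n \<omega>) j - p j)\<^sup>2) \<partial>M)"
    by (intro nn_integral_suminf measurable_compose[OF _ measurable_ennreal]
        statistic_measurable[of "\<lambda>x. real n * (emp n x _ - p _)\<^sup>2"])
  also have "\<dots> \<le> (\<Sum>j. ennreal (p j))"
  proof (rule suminf_le)
    fix j
    have "(\<integral>\<^sup>+\<omega>. ennreal (real n * (emp n (X n \<omega>) j - p j)\<^sup>2) \<partial>M)
        = ennreal (expectation (\<lambda>\<omega>. real n * (emp n (X n \<omega>) j - p j)\<^sup>2))"
      by (rule nn_integral_eq_integral) (use emp_variance(1)[OF n] in auto)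
    also have "\<dots> \<le> ennreal (p j)"
      using emp_variance(2)[OF n, of j] n by (intro ennreal_leI) (simp add: field_simps)
    finally show "(\<integral>\<^sup>+\<omega>. ennreal (real n * (emp n (X n \<omega>) j - p j)\<^sup>2) \<partial>M) \<le> ennreal (p j)" .
  qed auto
  also have "\<dots> = 1"
    using suminf_ennreal2[OF pvecs_nonneg[OF p] pvecs_summable[OF p]] by (simp add: pvecs_suminf[OF p])
  finally show ?thesis .
qed

lemma nn_integral_l1_emp:
  assumes n: "1 \<le> n" and sm: "summable (\<lambda>j. sqrt (p j))"
  shows "(\<integral>\<^sup>+\<omega>. ennreal (sqrt (real n) * lnorm 1 (\<lambda>j. emp n (X n \<omega>) j - p j)) \<partial>M)
      \<le> ennreal (\<Sum>j. sqrt (p j))"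
proof -
  have "(\<integral>\<^sup>+\<omega>. ennreal (sqrt (real n) * lnorm 1 (\<lambda>j. emp n (X n \<omega>) j - p j)) \<partial>M)
      = (\<integral>\<^sup>+\<omega>. (\<Sum>j. ennreal (sqrt (real n) * \<bar>emp n (X n \<omega>) j - p j\<bar>)) \<partial>M)"
  proof (rule nn_integral_cong)
    fix \<omega> assume "\<omega> \<in> space M"
    then have sm: "summable (\<lambda>j. \<bar>emp n (X n \<omega>) j - p j\<bar>)"
      using pvecs_diff_abs_summable[OF emp_in_pvecs[OF counts_in_freq_data n] p] by simp
    show "ennreal (sqrt (real n) * lnorm 1 (\<lambda>j. emp n (X n \<omega>) j - p j))
        = (\<Sum>j. ennreal (sqrt (real n) * \<bar>emp n (X n \<omega>) j - p j\<bar>))"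
      unfolding lnorm_1 suminf_mult[OF sm, symmetric]
      by (rule suminf_ennreal2[symmetric]) (use summable_mult[OF sm] in auto)
  qed
  also have "\<dots> = (\<Sum>j. \<integral>\<^sup>+\<omega>. ennreal (sqrt (real n) * \<bar>emp n (X n \<omega>) j - p j\<bar>) \<partial>M)"
    by (intro nn_integral_suminf measurable_compose[OF _ measurable_ennreal]
        statistic_measurable[of "\<lambda>x. sqrt (real n) * \<bar>emp n x _ - p _\<bar>"])
  also have "\<dots> \<le> (\<Sum>j. ennreal (sqrt (p j)))"
  proof (rule suminf_le)
    fix j
    have "(\<integral>\<^sup>+\<omega>. ennreal (sqrt (real n) * \<bar>emp n (X n \<omega>) j - p j\<bar>) \<partial>M)
        = ennreal (expectation (\<lambda>\<omega>. sqrt (real n) * \<bar>emp n (X n \<omega>) j - p j\<bar>))"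
      by (rule nn_integral_eq_integral) (use emp_abs_deviation(1)[OF n] in auto)
    also have "\<dots> \<le> ennreal (sqrt (p j))"
      using emp_abs_deviation(2)[OF n, of j] n by (intro ennreal_leI) (simp add: field_simps)
    finally show "(\<integral>\<^sup>+\<omega>. ennreal (sqrt (real n) * \<bar>emp n (X n \<omega>) j - p j\<bar>) \<partial>M) \<le> ennreal (sqrt (p j))" .
  qed auto
  also have "\<dots> = ennreal (\<Sum>j. sqrt (p j))"
    by (rule suminf_ennreal2) (use pvecs_nonneg[OF p] sm in auto)
  finally show ?thesis .
qed

text \<open>Hoeffding's inequality gives deviation probabilities that decay geometrically in
  \<open>n\<close>, hence are summable, and Borel-Cantelli applies.\<close>

lemma emp_AE_pointwise: "AE \<omega> in M. (\<lambda>n. emp n (X n \<omega>) j) \<longlonglongrightarrow> p j"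
proof (cases "j \<in> J")
  case True
  \<comment> \<open>Countably many thresholds \<open>1 / (m + 1)\<close> allow the exceptional null
    sets to be united.\<close>
  define B where "B m n = {\<omega> \<in> space M. 1 / real (Suc m) \<le> \<bar>emp n (X n \<omega>) j - p j\<bar>}" for m n
  have B: "B m n \<in> events" for m n
    unfolding B_def using statistic_measurable[of "\<lambda>x. \<bar>emp n x j - p j\<bar>" n] by measurable
  have prob_B: "prob (B m n) \<le> 2 * exp (- 2 * (1 / real (Suc m))\<^sup>2) ^ n" if n: "1 \<le> n" for m n
  proof -
    interpret H: Hoeffding_ineq M "{1..n}" "hit j" "\<lambda>_. 0" "\<lambda>_. 1" "\<Sum>i=1..n. expectation (hit j i)"
    proof unfold_locales
      show "indep_vars (\<lambda>_. borel) (hit j) {1..n}" by (rule hit_indep)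
      show "AE \<omega> in M. hit j i \<omega> \<in> {0..1}" for i by (simp add: hit_def indicator_def)
    qed simp_all
    have mu: "(\<Sum>i=1..n. expectation (hit j i)) = real n * p j"
      using expectation_hit[OF _ True] by simp
    have "1 / real (Suc m) \<le> \<bar>emp n (X n \<omega>) j - p j\<bar> \<longleftrightarrow>
        real n * (1 / real (Suc m)) \<le> \<bar>(\<Sum>i=1..n. hit j i \<omega>) - real n * p j\<bar>" for \<omega>
    proof -
      have "(\<Sum>i=1..n. hit j i \<omega>) - real n * p j = real n * (emp n (X n \<omega>) j - p j)"
        using n by (simp add: emp_minus_p[OF True n] sum_subtractf)
      then have eq: "\<bar>(\<Sum>i=1..n. hit j i \<omega>) - real n * p j\<bar> = real n * \<bar>emp n (X n \<omega>) j - p j\<bar>"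
        by (simp only: abs_mult abs_of_nat)
      show ?thesis unfolding eq using n by (intro mult_le_cancel_left_pos[symmetric]) simp
    qed
    then have "prob (B m n) = prob {\<omega> \<in> space M. real n * (1 / real (Suc m)) \<le>
        \<bar>(\<Sum>i=1..n. hit j i \<omega>) - (\<Sum>i=1..n. expectation (hit j i))\<bar>}"
      by (simp only: B_def mu)
    also have "\<dots> \<le> 2 * exp (- 2 * (real n * (1 / real (Suc m)))\<^sup>2 / (\<Sum>i=1..n. (1 - 0)\<^sup>2))"
      by (rule H.Hoeffding_ineq_abs_ge) (use n in auto)
    also have "- 2 * (real n * c)\<^sup>2 / (\<Sum>i=1..n. (1 - 0)\<^sup>2) = real n * (- 2 * c\<^sup>2)" for c :: real
      using n by (simp add: power2_eq_square)
    finally show ?thesis by (simp only: exp_of_nat_mult)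
  qed
  have "AE \<omega> in M. \<forall>\<^sub>F n in sequentially. \<omega> \<in> space M - B m n" for m
  proof (rule borel_cantelli_AE1)
    show "summable (\<lambda>n. prob (B m n))"
    proof (rule summable_comparison_test'[of _ 1])
      have "exp (- 2 * (1 / real (Suc m))\<^sup>2) < 1" by simp
      then show "summable (\<lambda>n. 2 * exp (- 2 * (1 / real (Suc m))\<^sup>2) ^ n)"
        by (intro summable_mult summable_geometric) simp
    qed (use prob_B in auto)
  qed (use B in \<open>auto simp: emeasure_eq_measure\<close>)
  then have "AE \<omega> in M. \<forall>m. \<forall>\<^sub>F n in sequentially. \<omega> \<in> space M - B m n"
    by (simp add: AE_all_countable)
  then show ?thesis
  proof eventually_elim
    case (elim \<omega>)
    show ?case
    proof (rule tendstoI)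
      fix e :: real assume "0 < e"
      then obtain m where m: "1 / real (Suc m) < e" using nat_approx_posE by blast
      show "\<forall>\<^sub>F n in sequentially. dist (emp n (X n \<omega>) j) (p j) < e"
        using elim[rule_format, of m] by eventually_elim (use m in \<open>auto simp: B_def dist_real_def\<close>)
    qed
  qed
next
  case False
  then have "emp n (X n \<omega>) j = p j" for n \<omega> using emp_outside by simp
  then show ?thesis by simp
qed

lemma emp_AE_l1: "AE \<omega> in M. (\<lambda>n. \<Sum>j. \<bar>emp n (X n \<omega>) j - p j\<bar>) \<longlonglongrightarrow> 0"
proof -
  have "AE \<omega> in M. \<forall>j. (\<lambda>n. emp n (X n \<omega>) j) \<longlonglongrightarrow> p j"
    using emp_AE_pointwise by (simp add: AE_all_countable)
  with AE_space show ?thesis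
  proof eventually_elim
    case (elim \<omega>)
    have "\<forall>\<^sub>F n in sequentially. emp n (X n \<omega>) \<in> pvecs J"
      using eventually_ge_at_top[of 1]
      by eventually_elim (rule emp_in_pvecs[OF counts_in_freq_data[OF elim(1)]])
    then show ?case using elim(2) by (intro pvecs_pointwise_imp_l1[OF p]) auto
  qed
qed

lemma emp_prob_l1:
  assumes "0 < e"
  shows "(\<lambda>n. prob (space M - {\<omega> \<in> space M. (\<Sum>j. \<bar>emp n (X n \<omega>) j - p j\<bar>) \<le> e})) \<longlonglongrightarrow> 0"
proof -
  have "space M - {\<omega> \<in> space M. (\<Sum>j. \<bar>emp n (X n \<omega>) j - p j\<bar>) \<le> e}
      = {\<omega> \<in> space M. e < (\<Sum>j. \<bar>emp n (X n \<omega>) j - p j\<bar>)}" for n by auto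
  then show ?thesis
    using AE_tendsto_zero_imp_prob[OF statistic_measurable[of "\<lambda>x. \<Sum>j. \<bar>emp _ x j - p j\<bar>"] emp_AE_l1 assms]
    by simp
qed

text \<open>The map \<open>h\<close> is generic so that the projection and the Grenander-Stone
  estimator share one argument. Nesting of norms reduces \<open>k \<ge> 2\<close> to
  \<open>k = 2\<close>.\<close>

lemma bigO_prob_lnorm_2:
  assumes e: "0 < e" and C: "0 \<le> C" and k: "2 \<le> k"
    and est: "\<And>n x. x \<in> freq_data J n \<Longrightarrow> 1 \<le> n \<Longrightarrow> h n x \<in> pvecs J"
    and bound: "\<forall>\<^sub>F n in sequentially. \<forall>x\<in>freq_data J n. (\<Sum>j. \<bar>emp n x j - p j\<bar>) \<le> e \<longrightarrow>
      lnorm 2 (\<lambda>j. h n x j - p j) \<le> 2 * lnorm 2 (\<lambda>j. emp n x j - p j) + C / real n"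
  shows "bigO_prob M (\<lambda>n \<omega>. sqrt (real n) * lnorm k (\<lambda>j. h n (X n \<omega>) j - p j)) 0"
\<comment> \<open>Only the mean of \<open>S = n * sq_dist\<close> is controlled, by
  \<open>1\<close>; \<open>sqrt S \<le> 1 + S\<close> makes it usable for the norm itself, whence
  \<open>A = 1 + S\<close> and \<open>K = 2\<close>.\<close>
proof (rule bigO_prob_zeroI[where A = "\<lambda>n \<omega>. 1 + real n * sq_dist p (emp n (X n \<omega>))" and K = 2 and C = C
      and E = "\<lambda>n. {\<omega> \<in> space M. (\<Sum>j. \<bar>emp n (X n \<omega>) j - p j\<bar>) \<le> e}"])
  show "(\<lambda>\<omega>. sqrt (real n) * lnorm k (\<lambda>j. h n (X n \<omega>) j - p j)) \<in> borel_measurable M" for n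
    by (rule statistic_measurable[of "\<lambda>x. sqrt (real n) * lnorm k (\<lambda>j. h n x j - p j)"])
  show "(\<lambda>\<omega>. 1 + real n * sq_dist p (emp n (X n \<omega>))) \<in> borel_measurable M" for n
    by (rule statistic_measurable[of "\<lambda>x. 1 + real n * sq_dist p (emp n x)"])
  show "{\<omega> \<in> space M. (\<Sum>j. \<bar>emp n (X n \<omega>) j - p j\<bar>) \<le> e} \<in> events" for n
    using statistic_measurable[of "\<lambda>x. \<Sum>j. \<bar>emp n x j - p j\<bar>" n] by measurable
  show "(\<lambda>n. prob (space M - {\<omega> \<in> space M. (\<Sum>j. \<bar>emp n (X n \<omega>) j - p j\<bar>) \<le> e})) \<longlonglongrightarrow> 0"
    by (rule emp_prob_l1[OF e])
  show "(\<integral>\<^sup>+\<omega>. ennreal (1 + real n * sq_dist p (emp n (X n \<omega>))) \<partial>M) \<le> ennreal 2" if n: "1 \<le> n" for n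
  proof -
    have "(\<integral>\<^sup>+\<omega>. ennreal (1 + real n * sq_dist p (emp n (X n \<omega>))) \<partial>M)
        = (\<integral>\<^sup>+\<omega>. 1 + ennreal (real n * sq_dist p (emp n (X n \<omega>))) \<partial>M)"
    proof (rule nn_integral_cong)
      fix \<omega> assume \<omega>: "\<omega> \<in> space M"
      have "0 \<le> sq_dist p (emp n (X n \<omega>))"
        unfolding sq_dist_eq
        by (intro l2_inner_self_nonneg pvecs_diff_sqsum[of _ J] p emp_in_pvecs[OF counts_in_freq_data[OF \<omega>] n])
      then show "ennreal (1 + real n * sq_dist p (emp n (X n \<omega>)))
          = 1 + ennreal (real n * sq_dist p (emp n (X n \<omega>)))"
        by (subst ennreal_plus) auto
    qed
    also have "\<dots> = 1 + (\<integral>\<^sup>+\<omega>. ennreal (real n * sq_dist p (emp n (X n \<omega>))) \<partial>M)"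
      by (subst nn_integral_add)
         (auto intro!: measurable_compose[OF _ measurable_ennreal] simp: emeasure_space_1
           statistic_measurable[of "\<lambda>x. real n * sq_dist p (emp n x)"])
    also have "\<dots> \<le> 1 + 1" by (intro add_left_mono nn_integral_sq_dist_emp n)
    finally show ?thesis by simp
  qed
  show "\<forall>\<^sub>F n in sequentially. \<forall>\<omega>\<in>{\<omega> \<in> space M. (\<Sum>j. \<bar>emp n (X n \<omega>) j - p j\<bar>) \<le> e}.
      \<bar>sqrt (real n) * lnorm k (\<lambda>j. h n (X n \<omega>) j - p j)\<bar> \<le> 2 * (1 + real n * sq_dist p (emp n (X n \<omega>))) + C"
    using bound eventually_ge_at_top[of 1]
  proof eventually_elim
    case (elim n)
    note n = elim(2)
    show ?case
    proof safe
      fix \<omega> assume \<omega>: "\<omega> \<in> space M" and le: "(\<Sum>j. \<bar>emp n (X n \<omega>) j - p j\<bar>) \<le> e"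
      define x where "x = X n \<omega>"
      have x: "x \<in> freq_data J n" unfolding x_def by (rule counts_in_freq_data[OF \<omega>])
      define S where "S = real n * sq_dist p (emp n x)"
      have "0 \<le> sq_dist p (emp n x)"
        unfolding sq_dist_eq by (intro l2_inner_self_nonneg pvecs_diff_sqsum[of _ J] p emp_in_pvecs[OF x n])
      then have S: "0 \<le> S" by (simp add: S_def)
      have hp: "summable (\<lambda>j. \<bar>h n x j - p j\<bar>)" by (rule pvecs_diff_abs_summable[OF est[OF x n] p])
      have "1 \<le> k" using k by (rule order_trans[rotated]) (simp add: one_enat_def numeral_eq_enat)
      then have "\<bar>sqrt (real n) * lnorm k (\<lambda>j. h n x j - p j)\<bar> = sqrt (real n) * lnorm k (\<lambda>j. h n x j - p j)"
        using lnorm_nonneg[OF _ hp] by simp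
      also have "\<dots> \<le> sqrt (real n) * (2 * lnorm 2 (\<lambda>j. emp n x j - p j) + C / real n)"
        using lnorm_le_lnorm_2[OF k pvecs_diff_sqsum[OF est[OF x n] p]] elim(1) x le
        by (intro mult_left_mono) (auto simp: x_def[symmetric] intro: order_trans)
      also have "\<dots> = 2 * sqrt S + C * (sqrt (real n) / real n)"
        by (simp add: S_def lnorm_2 sq_dist_def real_sqrt_mult algebra_simps)
      also have "\<dots> \<le> 2 * (1 + S) + C * 1"
      proof (intro add_mono mult_left_mono)
        show "sqrt S \<le> 1 + S" using S by (intro real_le_lsqrt) (auto simp: power2_eq_square algebra_simps)
        have "sqrt (real n) \<le> sqrt ((real n)\<^sup>2)" using n by (intro real_sqrt_le_mono) (simp add: power2_eq_square)
        then show "sqrt (real n) / real n \<le> 1" using n by simp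
      qed (use C in auto)
      finally show "\<bar>sqrt (real n) * lnorm k (\<lambda>j. h n (X n \<omega>) j - p j)\<bar>
          \<le> 2 * (1 + real n * sq_dist p (emp n (X n \<omega>))) + C"
        by (simp add: x_def S_def)
    qed
  qed
qed (use C in auto)

lemma bigO_prob_lnorm_1:
  assumes e: "0 < e" and C: "0 \<le> C" and sm: "summable (\<lambda>j. sqrt (p j))"
    and est: "\<And>n x. x \<in> freq_data J n \<Longrightarrow> 1 \<le> n \<Longrightarrow> h n x \<in> pvecs J"
    and bound: "\<forall>\<^sub>F n in sequentially. \<forall>x\<in>freq_data J n. (\<Sum>j. \<bar>emp n x j - p j\<bar>) \<le> e \<longrightarrow>
      lnorm 1 (\<lambda>j. h n x j - p j) \<le> lnorm 1 (\<lambda>j. emp n x j - p j) + C / real n"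
  shows "bigO_prob M (\<lambda>n \<omega>. sqrt (real n) * lnorm 1 (\<lambda>j. h n (X n \<omega>) j - p j)) 0"
proof (rule bigO_prob_zeroI[where A = "\<lambda>n \<omega>. sqrt (real n) * lnorm 1 (\<lambda>j. emp n (X n \<omega>) j - p j)"
      and K = "\<Sum>j. sqrt (p j)" and C = C
      and E = "\<lambda>n. {\<omega> \<in> space M. (\<Sum>j. \<bar>emp n (X n \<omega>) j - p j\<bar>) \<le> e}"])
  show "(\<lambda>\<omega>. sqrt (real n) * lnorm 1 (\<lambda>j. h n (X n \<omega>) j - p j)) \<in> borel_measurable M" for n
    by (rule statistic_measurable[of "\<lambda>x. sqrt (real n) * lnorm 1 (\<lambda>j. h n x j - p j)"])
  show "(\<lambda>\<omega>. sqrt (real n) * lnorm 1 (\<lambda>j. emp n (X n \<omega>) j - p j)) \<in> borel_measurable M" for n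
    by (rule statistic_measurable[of "\<lambda>x. sqrt (real n) * lnorm 1 (\<lambda>j. emp n x j - p j)"])
  show "{\<omega> \<in> space M. (\<Sum>j. \<bar>emp n (X n \<omega>) j - p j\<bar>) \<le> e} \<in> events" for n
    using statistic_measurable[of "\<lambda>x. \<Sum>j. \<bar>emp n x j - p j\<bar>" n] by measurable
  show "(\<lambda>n. prob (space M - {\<omega> \<in> space M. (\<Sum>j. \<bar>emp n (X n \<omega>) j - p j\<bar>) \<le> e})) \<longlonglongrightarrow> 0"
    by (rule emp_prob_l1[OF e])
  show "0 \<le> (\<Sum>j. sqrt (p j))" by (rule suminf_nonneg[OF sm]) (simp add: pvecs_nonneg[OF p])
  show "\<forall>\<^sub>F n in sequentially. \<forall>\<omega>\<in>{\<omega> \<in> space M. (\<Sum>j. \<bar>emp n (X n \<omega>) j - p j\<bar>) \<le> e}.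
      \<bar>sqrt (real n) * lnorm 1 (\<lambda>j. h n (X n \<omega>) j - p j)\<bar>
        \<le> 2 * (sqrt (real n) * lnorm 1 (\<lambda>j. emp n (X n \<omega>) j - p j)) + C"
    using bound eventually_ge_at_top[of 1]
  proof eventually_elim
    case (elim n)
    note n = elim(2)
    show ?case
    proof safe
      fix \<omega> assume \<omega>: "\<omega> \<in> space M" and le: "(\<Sum>j. \<bar>emp n (X n \<omega>) j - p j\<bar>) \<le> e"
      define x where "x = X n \<omega>"
      have x: "x \<in> freq_data J n" unfolding x_def by (rule counts_in_freq_data[OF \<omega>])
      have hp: "summable (\<lambda>j. \<bar>h n x j - p j\<bar>)" by (rule pvecs_diff_abs_summable[OF est[OF x n] p])
      have ep: "0 \<le> lnorm 1 (\<lambda>j. emp n x j - p j)"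
        by (rule lnorm_nonneg[OF order_refl pvecs_diff_abs_summable[OF emp_in_pvecs[OF x n] p]])
      have "\<bar>sqrt (real n) * lnorm 1 (\<lambda>j. h n x j - p j)\<bar> = sqrt (real n) * lnorm 1 (\<lambda>j. h n x j - p j)"
        using lnorm_nonneg[OF order_refl hp] by simp
      also have "\<dots> \<le> sqrt (real n) * (lnorm 1 (\<lambda>j. emp n x j - p j) + C / real n)"
        using elim(1) x le by (intro mult_left_mono) (auto simp: x_def[symmetric])
      also have "\<dots> = sqrt (real n) * lnorm 1 (\<lambda>j. emp n x j - p j) + C * (sqrt (real n) / real n)"
        by (simp add: algebra_simps)
      also have "\<dots> \<le> 2 * (sqrt (real n) * lnorm 1 (\<lambda>j. emp n x j - p j)) + C * 1"
      proof (intro add_mono mult_left_mono)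
        show "sqrt (real n) * lnorm 1 (\<lambda>j. emp n x j - p j) \<le> 2 * (sqrt (real n) * lnorm 1 (\<lambda>j. emp n x j - p j))"
          using ep by simp
        have "sqrt (real n) \<le> sqrt ((real n)\<^sup>2)" using n by (intro real_sqrt_le_mono) (simp add: power2_eq_square)
        then show "sqrt (real n) / real n \<le> 1" using n by simp
      qed (use C in auto)
      finally show "\<bar>sqrt (real n) * lnorm 1 (\<lambda>j. h n (X n \<omega>) j - p j)\<bar>
          \<le> 2 * (sqrt (real n) * lnorm 1 (\<lambda>j. emp n (X n \<omega>) j - p j)) + C"
        by (simp add: x_def)
    qed
  qed
qed (use C nn_integral_l1_emp[OF _ sm] in auto)

end

section \<open>Consistency and rates for isotonic regression of a sample\<close>

locale isotonic_sample = isotonic_regression J le T + iid_sample M J S s z p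
  for J :: "nat set" and le :: "nat \<Rightarrow> nat \<Rightarrow> bool" and T :: "(nat \<Rightarrow> real) \<Rightarrow> nat \<Rightarrow> real"
    and M :: "'w measure" and S :: "'a set" and s :: "nat \<Rightarrow> 'a" and z :: "nat \<Rightarrow> 'w \<Rightarrow> 'a"
    and p :: "nat \<Rightarrow> real"
begin

lemma root_n_rate_if_fixed_T: "root_n_rate_if_fixed M T p X"
  unfolding root_n_rate_if_fixed_def
proof (intro impI conjI allI)
  assume eq: "T p = p"
  have est: "T (emp n x) \<in> pvecs J" if "x \<in> freq_data J n" "1 \<le> n" for n x
    by (rule T_pvecs[OF emp_in_pvecs[OF that]])
  have b1: "lnorm 1 (\<lambda>j. T (emp n x) j - p j) \<le> lnorm 1 (\<lambda>j. emp n x j - p j) + 0 / real n"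
    and b2: "lnorm 2 (\<lambda>j. T (emp n x) j - p j) \<le> 2 * lnorm 2 (\<lambda>j. emp n x j - p j) + 0 / real n"
    if x: "x \<in> freq_data J n" and n: "1 \<le> n" for n x
  proof -
    note f = emp_in_pvecs[OF x n]
    show "lnorm 1 (\<lambda>j. T (emp n x) j - p j) \<le> lnorm 1 (\<lambda>j. emp n x j - p j) + 0 / real n"
      using T_l1_contraction[OF f p] by (simp add: lnorm_1 eq)
    have "lnorm 2 (\<lambda>j. T (emp n x) j - p j) \<le> lnorm 2 (\<lambda>j. emp n x j - p j)"
      using T_sq_dist_contraction[OF f p] by (simp add: lnorm_2 eq sq_dist_def)
    moreover have "0 \<le> lnorm 2 (\<lambda>j. emp n x j - p j)"
      unfolding lnorm_2 real_sqrt_ge_0_iff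
      by (rule suminf_nonneg) (use pvecs_diff_sqsum[OF f p] in \<open>auto simp: sqsum_def\<close>)
    ultimately show "lnorm 2 (\<lambda>j. T (emp n x) j - p j) \<le> 2 * lnorm 2 (\<lambda>j. emp n x j - p j) + 0 / real n"
      by simp
  qed
  show "bigO_prob M (\<lambda>n \<omega>. sqrt (real n) * lnorm k (\<lambda>j. T (emp n (X n \<omega>)) j - p j)) 0" if "2 \<le> k" for k
    \<comment> \<open>The bound holds for all data with \<open>n \<ge> 1\<close>, so the radius
      \<open>e = 1\<close> is an arbitrary choice, and \<open>C = 0\<close>.\<close>
    by (rule bigO_prob_lnorm_2[OF zero_less_one order_refl that est])
       (use b2 in \<open>auto intro!: eventually_sequentiallyI[of 1]\<close>)
  show "bigO_prob M (\<lambda>n \<omega>. sqrt (real n) * lnorm 1 (\<lambda>j. T (emp n (X n \<omega>)) j - p j)) 0"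
    if "summable (\<lambda>j. sqrt (p j))"
    by (rule bigO_prob_lnorm_1[OF zero_less_one order_refl that est])
       (use b1 in \<open>auto intro!: eventually_sequentiallyI[of 1]\<close>)
qed

text \<open>Every norm is at most the \<open>\<ell>\<^sub>1\<close> norm, which is eventually
  squeezed by the \<open>\<ell>\<^sub>1\<close> error of \<open>emp\<close> plus
  \<open>C / n\<close>.\<close>

lemma stone_strongly_consistent:
  assumes d: "d \<in> {1, 2}" and k: "1 \<le> k"
  shows "AE \<omega> in M. (\<lambda>n. lnorm k (\<lambda>j. stone_estimator d T n (X n \<omega>) j - p j)) \<longlonglongrightarrow> 0"
proof -
  obtain C e where "0 < e" and ev: "\<forall>\<^sub>F n in sequentially. \<forall>x\<in>freq_data J n.
    (\<Sum>j. \<bar>emp n x j - p j\<bar>) \<le> e \<longrightarrow>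
      lnorm 1 (\<lambda>j. stone_estimator d T n x j - p j) \<le> lnorm 1 (\<lambda>j. emp n x j - p j) + C / real n \<and>
      lnorm 2 (\<lambda>j. stone_estimator d T n x j - p j) \<le> 2 * lnorm 2 (\<lambda>j. emp n x j - p j) + C / real n"
    using stone_error[OF p d] by blast
  show ?thesis
    using emp_AE_l1 AE_space
  proof eventually_elim
    case (elim \<omega>)
    note fd = counts_in_freq_data[OF elim(2)]
    have small: "\<forall>\<^sub>F n in sequentially. (\<Sum>j. \<bar>emp n (X n \<omega>) j - p j\<bar>) < e"
      using order_tendstoD(2)[OF elim(1) \<open>0 < e\<close>] .
    have sm: "summable (\<lambda>j. \<bar>stone_estimator d T n (X n \<omega>) j - p j\<bar>)" if "1 \<le> n" for n
      by (rule pvecs_diff_abs_summable[OF stone_estimator_in_pvecs[OF fd that] p])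
    show ?case
    proof (rule tendsto_sandwich)
      show "(\<lambda>_. 0 :: real) \<longlonglongrightarrow> 0" by simp
      have "(\<lambda>n. (\<Sum>j. \<bar>emp n (X n \<omega>) j - p j\<bar>) + C * (1 / real n)) \<longlonglongrightarrow> 0 + C * 0"
        by (intro tendsto_add elim tendsto_mult tendsto_const lim_1_over_n)
      then show "(\<lambda>n. (\<Sum>j. \<bar>emp n (X n \<omega>) j - p j\<bar>) + C / real n) \<longlonglongrightarrow> 0" by simp
      show "\<forall>\<^sub>F n in sequentially. 0 \<le> lnorm k (\<lambda>j. stone_estimator d T n (X n \<omega>) j - p j)"
        using eventually_ge_at_top[of 1] by eventually_elim (intro lnorm_nonneg[OF k] sm)
      show "\<forall>\<^sub>F n in sequentially. lnorm k (\<lambda>j. stone_estimator d T n (X n \<omega>) j - p j)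
          \<le> (\<Sum>j. \<bar>emp n (X n \<omega>) j - p j\<bar>) + C / real n"
        using ev small eventually_ge_at_top[of 1]
      proof eventually_elim
        case n: (elim n)
        have "lnorm k (\<lambda>j. stone_estimator d T n (X n \<omega>) j - p j)
            \<le> lnorm 1 (\<lambda>j. stone_estimator d T n (X n \<omega>) j - p j)"
          by (rule lnorm_le_lnorm_1[OF k sm[OF n(3)]])
        also have "\<dots> \<le> lnorm 1 (\<lambda>j. emp n (X n \<omega>) j - p j) + C / real n"
          using n(1) fd n(2) by simp
        finally show ?case by (simp add: lnorm_1)
      qed
    qed
  qed
qed

lemma stone_rate:
  assumes d: "d \<in> {1, 2}"
  shows "2 \<le> k \<Longrightarrow>
      bigO_prob M (\<lambda>n \<omega>. sqrt (real n) * lnorm k (\<lambda>j. stone_estimator d T n (X n \<omega>) j - p j)) 0"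
    and "summable (\<lambda>j. sqrt (p j)) \<Longrightarrow>
      bigO_prob M (\<lambda>n \<omega>. sqrt (real n) * lnorm 1 (\<lambda>j. stone_estimator d T n (X n \<omega>) j - p j)) 0"
proof -
  obtain C e where C: "0 \<le> C" and e: "0 < e" and ev: "\<forall>\<^sub>F n in sequentially. \<forall>x\<in>freq_data J n.
    (\<Sum>j. \<bar>emp n x j - p j\<bar>) \<le> e \<longrightarrow>
      lnorm 1 (\<lambda>j. stone_estimator d T n x j - p j) \<le> lnorm 1 (\<lambda>j. emp n x j - p j) + C / real n \<and>
      lnorm 2 (\<lambda>j. stone_estimator d T n x j - p j) \<le> 2 * lnorm 2 (\<lambda>j. emp n x j - p j) + C / real n"
    using stone_error[OF p d] by blast
  have ev1: "\<forall>\<^sub>F n in sequentially. \<forall>x\<in>freq_data J n. (\<Sum>j. \<bar>emp n x j - p j\<bar>) \<le> e \<longrightarrow>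
      lnorm 1 (\<lambda>j. stone_estimator d T n x j - p j) \<le> lnorm 1 (\<lambda>j. emp n x j - p j) + C / real n"
    and ev2: "\<forall>\<^sub>F n in sequentially. \<forall>x\<in>freq_data J n. (\<Sum>j. \<bar>emp n x j - p j\<bar>) \<le> e \<longrightarrow>
      lnorm 2 (\<lambda>j. stone_estimator d T n x j - p j) \<le> 2 * lnorm 2 (\<lambda>j. emp n x j - p j) + C / real n"
    using ev by (auto elim: eventually_mono)
  show "bigO_prob M (\<lambda>n \<omega>. sqrt (real n) * lnorm k (\<lambda>j. stone_estimator d T n (X n \<omega>) j - p j)) 0" if "2 \<le> k"
    by (rule bigO_prob_lnorm_2[OF e C that stone_estimator_in_pvecs ev2])
  show "bigO_prob M (\<lambda>n \<omega>. sqrt (real n) * lnorm 1 (\<lambda>j. stone_estimator d T n (X n \<omega>) j - p j)) 0"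
    if "summable (\<lambda>j. sqrt (p j))"
    by (rule bigO_prob_lnorm_1[OF e C that stone_estimator_in_pvecs ev1])
qed

end

text \<open>The first conjunct gives the others their meaning: without a minimiser,
  \<open>isotonic_proj\<close> would be unspecified. The next five are the properties (i) to (v),
  the last three the claims (a) to (c).\<close>

theorem theorem5:
  fixes S :: "'a set" and r :: "'a rel" and J :: "nat set" and s :: "nat \<Rightarrow> 'a"
    and M :: "'w measure" and z :: "nat \<Rightarrow> 'w \<Rightarrow> 'a" and p :: "nat \<Rightarrow> real"
    and d :: nat
  defines "T \<equiv> isotonic_proj J s r"
    and "x \<equiv> counts J s z"
  defines "\<phi> \<equiv> (\<lambda>n \<omega>. stone_estimator d T n (x n \<omega>))"
  assumes order: "partial_order_on S r"
    and enum: "bij_betw s J S" "J = UNIV \<or> (\<exists>N. J = {..<N})"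
    and up_finite: "\<forall>a\<in>S. finite {b \<in> S. (a, b) \<in> r}"
    and p: "p \<in> pvecs J"
    and M: "prob_space M"
    and indep: "prob_space.indep_vars M (\<lambda>_. count_space S) z {1..}"
    and pmf: "\<forall>i\<ge>1. \<forall>j\<in>J. measure M {\<omega> \<in> space M. z i \<omega> = s j} = p j"
    and d: "d \<in> {1, 2}"
  shows "(\<forall>g\<in>pvecs J. \<exists>!f. is_arg_min (sq_dist g) (\<lambda>f. f \<in> isotonic_pvecs J s r) f) \<and>
    l2_continuous J T \<and>
    linf_contraction J T \<and>
    orthogonal_residual J T \<and>
    loo_dominated J T \<and>
    root_n_rate_if_fixed M T p x \<and>
    (\<forall>k. 1 \<le> k \<longrightarrow> (AE \<omega> in M. (\<lambda>n. lnorm k (\<lambda>j. \<phi> n \<omega> j - p j)) \<longlonglongrightarrow> 0)) \<and>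
    (\<forall>k. 2 \<le> k \<longrightarrow> bigO_prob M (\<lambda>n \<omega>. sqrt (real n) * lnorm k (\<lambda>j. \<phi> n \<omega> j - p j)) 0) \<and>
    (summable (\<lambda>j. sqrt (p j)) \<longrightarrow>
       bigO_prob M (\<lambda>n \<omega>. sqrt (real n) * lnorm 1 (\<lambda>j. \<phi> n \<omega> j - p j)) 0)"
proof -
  define le where "le = (\<lambda>i j. (s i, s j) \<in> r)"
  have inj: "inj_on s J" and sJ: "\<And>j. j \<in> J \<Longrightarrow> s j \<in> S"
    using enum(1) by (auto simp: bij_betw_def)
  interpret finite_upset_preorder J le
  proof
    show "le i i" if "i \<in> J" for i
      using order sJ[OF that] by (simp add: le_def partial_order_on_def preorder_on_def refl_on_def)
    show "le i k" if "le i j" "le j k" for i j k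
      using order that by (auto simp: le_def partial_order_on_def preorder_on_def elim: transD)
    show "finite {j \<in> J. le i j}" if i: "i \<in> J" for i
    proof (rule finite_imageD)
      have "s ` {j \<in> J. le i j} \<subseteq> {b \<in> S. (s i, b) \<in> r}" using sJ by (auto simp: le_def)
      then show "finite (s ` {j \<in> J. le i j})"
        by (rule finite_subset) (use up_finite sJ[OF i] in blast)
      show "inj_on s {j \<in> J. le i j}" by (rule inj_on_subset[OF inj]) auto
    qed
  qed
  have iso: "f \<in> isotonic_pvecs J s r \<longleftrightarrow> f \<in> pvecs J \<and> (\<forall>i\<in>J. \<forall>j\<in>J. le i j \<longrightarrow> f i \<le> f j)" for f
    by (simp add: isotonic_pvecs_def le_def)
  have min_iff: "is_arg_min (sq_dist g) (\<lambda>f. f \<in> isotonic_pvecs J s r) f \<longleftrightarrow> f = u"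
    if "g \<in> pvecs J" "is_proj g u" for g u f
    by (rule is_arg_min_iff_is_proj[OF that iso])
  have unique: "\<exists>!f. is_arg_min (sq_dist g) (\<lambda>f. f \<in> isotonic_pvecs J s r) f" if g: "g \<in> pvecs J" for g
    using ex_is_proj[OF pvecs_sqsum[OF g]] min_iff[OF g] by auto
  interpret isotonic_regression J le T
  proof
    fix g assume g: "g \<in> pvecs J"
    obtain u where u: "is_proj g u" using ex_is_proj[OF pvecs_sqsum[OF g]] by blast
    then show "is_proj g (T g)"
      \<comment> \<open>\<open>arg_min\<close> selects some minimiser, and by \<open>min_iff\<close>
        the only one is \<open>u\<close>.\<close>
      by (simp add: T_def isotonic_proj_def arg_min_def min_iff[OF g u])
  qed
  interpret iid_sample M J S s z p
    by (intro iid_sample.intro iid_sample_axioms.intro M enum(1) p indep) (use pmf in simp)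
  interpret isotonic_sample J le T M S s z p ..
  show ?thesis
    unfolding \<phi>_def x_def
    by (intro conjI ballI allI impI unique l2_continuous_T linf_contraction_T orthogonal_residual_T
        loo_dominated_T root_n_rate_if_fixed_T stone_strongly_consistent[OF d] stone_rate[OF d])
qed

end
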